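(* Let $\kappa$ be an infinite cardinal satisfying $\kappa^{\aleph_0}=\kappa$, and let $I$ be either the meagre ideal $\mathcal{M}$ or the null ideal $\mathcal{N}$ over ${}^\omega 2$. Then every ultrafilter on $\mathbb{B}(I,\kappa)$ is Tukey maximal, but $\mathbb{B}(I,\kappa)$ is not a free Boolean algebra. (In particular, an infinite Boolean algebra all of whose ultrafilters are Tukey maximal need not be free.)
   Context: $\mathcal{M}$ is the ideal of meagre subsets of ${}^\omega 2$, and $\mathcal{N}$ is the ideal of subsets of ${}^\omega 2$ that are null for the standard product measure. For $I\in\{\mathcal{M},\mathcal{N}\}$ and an infinite ordinal $\alpha$, let $I(\alpha)$ be the family of all $X\subseteq{}^\alpha 2$ for which there exist an injective $\Delta\colon\omega\to\alpha$ and $Y\in I$ such that $f\circ\Delta\in Y$ for all $f\in X$ (this is a $\sigma$-ideal over ${}^\alpha 2$). Let $\mathcal{B}({}^\alpha 2)$ be the $\sigma$-algebra of subsets of ${}^\alpha 2$ generated by the clopen subsets of the Cantor space ${}^\alpha 2$, and let $\mathbb{B}(I,\alpha)=\mathcal{B}({}^\alpha 2)/I(\alpha)$. For directed sets $\langle D,\le^D\rangle$, $\langle E,\le^E\rangle$, write $D\le_{\mathrm{T}}E$ if there are functions $f\colon D\to E$ and $g\colon E\to D$ such that for all $d\in D$, $e\in E$: $f(d)\le^E e\implies d\le^D g(e)$. An ultrafilter $U$ on a Boolean algebra $\mathbb{B}$ is regarded as the directed set $\langle U,\ge\rangle$ (reverse Boolean order), and $U$ is Tukey maximal if $\langle[\mathbb{B}]^{<\aleph_0},\subseteq\rangle\le_{\mathrm{T}}\langle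 U,\ge\rangle$, where $[\mathbb{B}]^{<\aleph_0}$ is the set of finite subsets of $\mathbb{B}$. *)

theory Defs
  imports "HOL-Algebra.Lattice" "HOL-Probability.Probability"
begin

unbundle cardinal_syntax

section \<open>Boolean algebras as complemented distributive lattices\<close>

locale boolean_lattice = bounded_lattice L for L +
  assumes meet_join_distrib:
      "\<lbrakk>x \<in> carrier L; y \<in> carrier L; z \<in> carrier L\<rbrakk>
        \<Longrightarrow> x \<sqinter>\<^bsub>L\<^esub> (y \<squnion>\<^bsub>L\<^esub> z) = (x \<sqinter>\<^bsub>L\<^esub> y) \<squnion>\<^bsub>L\<^esub> (x \<sqinter>\<^bsub>L\<^esub> z)"
    and complement_exists:
      "x \<in> carrier L \<Longrightarrow> \<exists>y\<in>carrier L. x \<sqinter>\<^bsub>L\<^esub> y = \<bottom>\<^bsub>L\<^esub> \<and> x \<squnion>\<^bsub>L\<^esub> y = \<top>\<^bsub>L\<^esub>"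

definition complement :: "'a gorder \<Rightarrow> 'a \<Rightarrow> 'a" where
  "complement L x =
     (THE y. y \<in> carrier L \<and> x \<sqinter>\<^bsub>L\<^esub> y = \<bottom>\<^bsub>L\<^esub> \<and> x \<squnion>\<^bsub>L\<^esub> y = \<top>\<^bsub>L\<^esub>)"

definition boolean_ultrafilter :: "'a gorder \<Rightarrow> 'a set \<Rightarrow> bool" where
  "boolean_ultrafilter L U \<longleftrightarrow>
     U \<subseteq> carrier L \<and> \<top>\<^bsub>L\<^esub> \<in> U \<and> \<bottom>\<^bsub>L\<^esub> \<notin> U \<and>
     (\<forall>x\<in>U. \<forall>y\<in>U. x \<sqinter>\<^bsub>L\<^esub> y \<in> U) \<and>
     (\<forall>x\<in>U. \<forall>y\<in>carrier L. x \<sqsubseteq>\<^bsub>L\<^esub> y \<longrightarrow> y \<in> U) \<and>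
     (\<forall>x\<in>carrier L. x \<in> U \<or> complement L x \<in> U)"

definition boolean_hom :: "'a gorder \<Rightarrow> 'b gorder \<Rightarrow> ('a \<Rightarrow> 'b) set" where
  "boolean_hom L M =
     {h \<in> carrier L \<rightarrow> carrier M.
       (\<forall>x\<in>carrier L. \<forall>y\<in>carrier L.
          h (x \<squnion>\<^bsub>L\<^esub> y) = h x \<squnion>\<^bsub>M\<^esub> h y \<and> h (x \<sqinter>\<^bsub>L\<^esub> y) = h x \<sqinter>\<^bsub>M\<^esub> h y) \<and>
       (\<forall>x\<in>carrier L. h (complement L x) = complement M (h x))}"

text \<open>
  The universal property of the free Boolean algebra on the set \<open>X\<close> of generators. HOL cannot
  quantify over types inside a definition, so the target \<open>M\<close> ranges over the Boolean algebras whose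
  carrier lives in the same type as that of \<open>L\<close>. As soon as this type has two elements, this is
  equivalent to the universal property for all Boolean algebras: the two-element targets force \<open>X\<close>
  to be independent, and uniqueness for the target \<open>L\<close> itself, together with existence for the
  subalgebra generated by \<open>X\<close>, forces \<open>X\<close> to generate \<open>L\<close>.
  The restriction to \<open>extensional\<close> makes a homomorphism determined by its values on the carrier.
\<close>

definition freely_generated_by :: "'a gorder \<Rightarrow> 'a set \<Rightarrow> bool" where
  "freely_generated_by L X \<longleftrightarrow>
     X \<subseteq> carrier L \<and>
     (\<forall>(M :: 'a gorder) f. boolean_lattice M \<and> f \<in> X \<rightarrow> carrier M \<longrightarrow>
        (\<exists>!h. h \<in> boolean_hom L M \<inter> extensional (carrier L) \<and> (\<forall>x\<in>X. h x = f x)))"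

definition free_boolean_lattice :: "'a gorder \<Rightarrow> bool" where
  "free_boolean_lattice L \<longleftrightarrow> boolean_lattice L \<and> (\<exists>X. freely_generated_by L X)"


section \<open>Tukey reducibility\<close>

definition tukey_le :: "'a gorder \<Rightarrow> 'b gorder \<Rightarrow> bool" where
  "tukey_le D E \<longleftrightarrow>
     (\<exists>f \<in> carrier D \<rightarrow> carrier E. \<exists>g \<in> carrier E \<rightarrow> carrier D.
        \<forall>d\<in>carrier D. \<forall>e\<in>carrier E. f d \<sqsubseteq>\<^bsub>E\<^esub> e \<longrightarrow> d \<sqsubseteq>\<^bsub>D\<^esub> g e)"

definition finite_subsets_order :: "'a set \<Rightarrow> 'a set gorder" where
  "finite_subsets_order A = \<lparr>carrier = Fpow A, eq = (=), le = (\<subseteq>)\<rparr>"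

definition tukey_maximal :: "'a gorder \<Rightarrow> 'a set \<Rightarrow> bool" where
  "tukey_maximal L U \<longleftrightarrow>
     tukey_le (finite_subsets_order (carrier L)) (inv_gorder (L\<lparr>carrier := U\<rparr>))"


section \<open>The meagre and null ideals and the algebras derived from them\<close>

text \<open>
  Here \<open>2\<close> is the type \<open>bool\<close>, and the points of the Cantor space over an index set \<open>A\<close> are the
  extensional functions \<open>A \<rightarrow>\<^sub>E UNIV\<close>; for \<open>A = UNIV\<close> these are all functions.
\<close>

definition cantor_space :: "'k set \<Rightarrow> ('k \<Rightarrow> bool) topology" where
  "cantor_space A = product_topology (\<lambda>_. discrete_topology UNIV) A"

definition nowhere_dense_in :: "'a topology \<Rightarrow> 'a set \<Rightarrow> bool" where
  "nowhere_dense_in T S \<longleftrightarrow> S \<subseteq> topspace T \<and> T interior_of (T closure_of S) = {}"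

definition meagre_in :: "'a topology \<Rightarrow> 'a set \<Rightarrow> bool" where
  "meagre_in T S \<longleftrightarrow> (\<exists>F. countable F \<and> (\<forall>N\<in>F. nowhere_dense_in T N) \<and> S = \<Union>F)"

definition meagre_ideal :: "(nat \<Rightarrow> bool) set set" where
  "meagre_ideal = {S. meagre_in (cantor_space UNIV) S}"

definition null_ideal :: "(nat \<Rightarrow> bool) set set" where
  "null_ideal = null_sets (completion (\<Pi>\<^sub>M i\<in>(UNIV :: nat set). uniform_count_measure (UNIV :: bool set)))"

definition lift_ideal :: "(nat \<Rightarrow> bool) set set \<Rightarrow> 'k set \<Rightarrow> ('k \<Rightarrow> bool) set set" where
  "lift_ideal I A =
     {X. X \<subseteq> topspace (cantor_space A) \<and>
         (\<exists>\<Delta> :: nat \<Rightarrow> 'k. \<exists>Y\<in>I. inj \<Delta> \<and> range \<Delta> \<subseteq> A \<and> (\<forall>f\<in>X. f \<circ> \<Delta> \<in> Y))}"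

definition clopen_sigma_algebra :: "'k set \<Rightarrow> ('k \<Rightarrow> bool) set set" where
  "clopen_sigma_algebra A =
     sigma_sets (topspace (cantor_space A))
       {C. openin (cantor_space A) C \<and> closedin (cantor_space A) C}"

definition quotient_algebra :: "'a set set \<Rightarrow> 'a set set \<Rightarrow> 'a set set gorder" where
  "quotient_algebra B J =
     \<lparr>carrier = B // {(X, Y). X \<in> B \<and> Y \<in> B \<and> (X - Y) \<union> (Y - X) \<in> J},
      eq = (=),
      le = (\<lambda>P Q. \<exists>X\<in>P. \<exists>Y\<in>Q. X - Y \<in> J)\<rparr>"

definition ideal_algebra :: "(nat \<Rightarrow> bool) set set \<Rightarrow> 'k set \<Rightarrow> ('k \<Rightarrow> bool) set set gorder" where
  "ideal_algebra I A = quotient_algebra (clopen_sigma_algebra A) (lift_ideal I A)"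

end

(*
  The coordinate half-spaces H(a) = {f. f a = b}, a < kappa, witness Tukey maximality. An ultrafilter
  contains, for each a, the class of one of the two half-spaces at a; a lower bound of infinitely
  many of these classes lies below the class of a closed set that fixes infinitely many coordinates,
  and such a set is meagre and null. So an ultrafilter contains kappa many elements no infinitely
  many of which have a lower bound in it, and kappa^omega = kappa bounds the number of Baire sets,
  hence of elements of the algebra, by kappa.

  The algebra is not free because it is atomless and closed under countable unions: an infinite free
  set x_0, x_1, ... of generators would yield, with y_n = x_n minus all earlier x_i, an element above
  every y_{2n} and disjoint from every y_{2n+1}, but each element of a free algebra depends on only
  finitely many generators.
*)
theory Submission
  imports Defs
begin

text \<open>Both halves rest on one property of the half-spaces, \<open>H_decide\<close>: a set in
  the algebra that, modulo the ideal, has prescribed values at infinitely many coordinates belongs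
  to the ideal. It keeps the values of the second Tukey map finite, makes the algebra atomless and
  makes it infinite. It is derived once, from closure properties shared by the meagre and the null
  ideal. Three obstacles shape the rest. Each member of a lifted ideal comes with its own countable
  set of coordinates, so closure under countable unions requires merging these sets. Two-valued
  homomorphisms respect only finite joins, so their value on a countable union has to be read off
  from coverings by finitely many sets. The universal property speaks only of targets in the type of
  the given algebra, so every target used is a subalgebra of that algebra. A finite set of
  generators must be excluded separately: some set outside the ideal would decide all generators,
  hence every set, against atomlessness.\<close>

section \<open>Boolean algebras and free generation\<close>

text \<open>The operations of the record are choices and descriptions relative to its order.
  Explicit \<open>j\<close>, \<open>m\<close>, \<open>c\<close>, given by their universal
  properties, make them computable; the quotient and its subalgebras both enter here.\<close>

lemma boolean_latticeI:
  fixes L :: "'a gorder"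
  assumes eq: "eq L = (=)"
    and refl: "\<And>x. x \<in> carrier L \<Longrightarrow> x \<sqsubseteq>\<^bsub>L\<^esub> x"
    and antisym: "\<And>x y. \<lbrakk>x \<sqsubseteq>\<^bsub>L\<^esub> y; y \<sqsubseteq>\<^bsub>L\<^esub> x; x \<in> carrier L; y \<in> carrier L\<rbrakk> \<Longrightarrow> x = y"
    and trans: "\<And>x y z. \<lbrakk>x \<sqsubseteq>\<^bsub>L\<^esub> y; y \<sqsubseteq>\<^bsub>L\<^esub> z; x \<in> carrier L; y \<in> carrier L; z \<in> carrier L\<rbrakk>
                  \<Longrightarrow> x \<sqsubseteq>\<^bsub>L\<^esub> z"
    and j: "\<And>x y. \<lbrakk>x \<in> carrier L; y \<in> carrier L\<rbrakk> \<Longrightarrow> j x y \<in> carrier L \<and>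
              (\<forall>z\<in>carrier L. j x y \<sqsubseteq>\<^bsub>L\<^esub> z \<longleftrightarrow> x \<sqsubseteq>\<^bsub>L\<^esub> z \<and> y \<sqsubseteq>\<^bsub>L\<^esub> z)"
    and m: "\<And>x y. \<lbrakk>x \<in> carrier L; y \<in> carrier L\<rbrakk> \<Longrightarrow> m x y \<in> carrier L \<and>
              (\<forall>z\<in>carrier L. z \<sqsubseteq>\<^bsub>L\<^esub> m x y \<longleftrightarrow> z \<sqsubseteq>\<^bsub>L\<^esub> x \<and> z \<sqsubseteq>\<^bsub>L\<^esub> y)"
    and b: "b \<in> carrier L" "\<And>x. x \<in> carrier L \<Longrightarrow> b \<sqsubseteq>\<^bsub>L\<^esub> x"
    and t: "t \<in> carrier L" "\<And>x. x \<in> carrier L \<Longrightarrow> x \<sqsubseteq>\<^bsub>L\<^esub> t"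
    and distrib: "\<And>x y z. \<lbrakk>x \<in> carrier L; y \<in> carrier L; z \<in> carrier L\<rbrakk>
                    \<Longrightarrow> m x (j y z) = j (m x y) (m x z)"
    and c: "\<And>x. x \<in> carrier L \<Longrightarrow> c x \<in> carrier L \<and> m x (c x) = b \<and> j x (c x) = t"
  shows "boolean_lattice L"
    and "\<And>x y. \<lbrakk>x \<in> carrier L; y \<in> carrier L\<rbrakk> \<Longrightarrow> x \<squnion>\<^bsub>L\<^esub> y = j x y"
    and "\<And>x y. \<lbrakk>x \<in> carrier L; y \<in> carrier L\<rbrakk> \<Longrightarrow> x \<sqinter>\<^bsub>L\<^esub> y = m x y"
    and "\<bottom>\<^bsub>L\<^esub> = b" and "\<top>\<^bsub>L\<^esub> = t"
    and "\<And>x. x \<in> carrier L \<Longrightarrow> complement L x = c x"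
proof -
  interpret partial_order L
    by unfold_locales (auto simp: eq intro: refl antisym trans)
  have lub: "least L (j x y) (Upper L {x, y})" if "x \<in> carrier L" "y \<in> carrier L" for x y
    using j[OF that] that by (auto simp: least_def Upper_def refl)
  have glb: "greatest L (m x y) (Lower L {x, y})" if "x \<in> carrier L" "y \<in> carrier L" for x y
    using m[OF that] that by (auto simp: greatest_def Lower_def refl)
  have bot: "least L b (carrier L)" and top: "greatest L t (carrier L)"
    using b t by (auto simp: least_def greatest_def)
  interpret bounded_lattice L
    using lub glb bot top by unfold_locales blast+
  show join: "x \<squnion>\<^bsub>L\<^esub> y = j x y" if "x \<in> carrier L" "y \<in> carrier L" for x y
    unfolding Lattice.join_def Lattice.sup_def by (rule some_equality) (auto intro: lub[OF that] least_unique)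
  show meet: "x \<sqinter>\<^bsub>L\<^esub> y = m x y" if "x \<in> carrier L" "y \<in> carrier L" for x y
    unfolding Lattice.meet_def Lattice.inf_def
    by (rule some_equality) (auto intro: glb[OF that] greatest_unique)
  show bot: "\<bottom>\<^bsub>L\<^esub> = b" and top: "\<top>\<^bsub>L\<^esub> = t"
    using bottom_eq[OF b] top_eq[OF t] by auto
  show "boolean_lattice L"
    by unfold_locales (auto simp: join meet bot top distrib j m intro!: bexI[of _ "c _"] dest: c)
  \<comment> \<open>y = y meet (x join z) = (y meet x) join (y meet z) \<le> z. Applied in both
    directions, this makes complements unique, so the definite description denotes.\<close>
  have below: "y \<sqsubseteq>\<^bsub>L\<^esub> z"
    if "x \<in> carrier L" "y \<in> carrier L" "z \<in> carrier L" "m x y = b" "j x z = t" for x y z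
  proof -
    have "y \<sqsubseteq>\<^bsub>L\<^esub> m y (j x z)"
      using that m[OF that(2) t(1)] t refl by auto
    also have "m y (j x z) = j (m y x) (m y z)"
      using that distrib by auto
    also have "m y x = m x y"
      using m[of x y] m[of y x] that by (intro antisym) (auto simp: refl)
    also have "j (m x y) (m y z) \<sqsubseteq>\<^bsub>L\<^esub> z"
      using that b m[of y z] j[of b "m y z"] refl[of "m y z"] by auto
    finally show ?thesis
      using that m[of x y] m[of y z] m[of y x] m[of y "j x z"] j[of x z] j[of "m x y" "m y z"] by auto
  qed
  show "complement L x = c x" if x: "x \<in> carrier L" for x
    unfolding complement_def bot top
  proof (rule the_equality)
    show "c x \<in> carrier L \<and> x \<sqinter>\<^bsub>L\<^esub> c x = b \<and> x \<squnion>\<^bsub>L\<^esub> c x = t"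
      using c[OF x] x by (simp add: meet join)
    show "y = c x" if "y \<in> carrier L \<and> x \<sqinter>\<^bsub>L\<^esub> y = b \<and> x \<squnion>\<^bsub>L\<^esub> y = t" for y
      using that c[OF x] x below[of x y "c x"] below[of x "c x" y] by (auto simp: meet join antisym)
  qed
qed

text \<open>The locale assumes only that some complement exists. A choice function \<open>c\<close>
  together with the lattice's own operations turns \<open>boolean_latticeI\<close> into a proof of
  uniqueness.\<close>

lemma
  fixes L :: "'a gorder"
  assumes "boolean_lattice L" and x: "x \<in> carrier L"
  shows complement_closed: "complement L x \<in> carrier L"
    and meet_complement: "x \<sqinter>\<^bsub>L\<^esub> complement L x = \<bottom>\<^bsub>L\<^esub>"
    and join_complement: "x \<squnion>\<^bsub>L\<^esub> complement L x = \<top>\<^bsub>L\<^esub>"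
proof -
  interpret boolean_lattice L by fact
  obtain c where c: "\<And>x. x \<in> carrier L \<Longrightarrow>
      c x \<in> carrier L \<and> x \<sqinter>\<^bsub>L\<^esub> c x = \<bottom>\<^bsub>L\<^esub> \<and> x \<squnion>\<^bsub>L\<^esub> c x = \<top>\<^bsub>L\<^esub>"
    using complement_exists by metis
  have j: "x \<squnion>\<^bsub>L\<^esub> y \<sqsubseteq>\<^bsub>L\<^esub> z \<longleftrightarrow> x \<sqsubseteq>\<^bsub>L\<^esub> z \<and> y \<sqsubseteq>\<^bsub>L\<^esub> z"
    if "x \<in> carrier L" "y \<in> carrier L" "z \<in> carrier L" for x y z
    using that join_left[of x y] join_right[of x y] by (metis join_closed join_le le_trans)
  have m: "z \<sqsubseteq>\<^bsub>L\<^esub> x \<sqinter>\<^bsub>L\<^esub> y \<longleftrightarrow> z \<sqsubseteq>\<^bsub>L\<^esub> x \<and> z \<sqsubseteq>\<^bsub>L\<^esub> y"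
    if "x \<in> carrier L" "y \<in> carrier L" "z \<in> carrier L" for x y z
    using that meet_left[of x y] meet_right[of x y] by (metis meet_closed meet_le le_trans)
  have "complement L x = c x"
  proof (rule boolean_latticeI(6)[where j = "Lattice.join L" and m = "Lattice.meet L"])
    fix x y z
    show "x \<in> carrier L \<Longrightarrow> x \<sqsubseteq>\<^bsub>L\<^esub> x"
      "\<lbrakk>x \<sqsubseteq>\<^bsub>L\<^esub> y; y \<sqsubseteq>\<^bsub>L\<^esub> x; x \<in> carrier L; y \<in> carrier L\<rbrakk> \<Longrightarrow> x = y"
      "\<lbrakk>x \<sqsubseteq>\<^bsub>L\<^esub> y; y \<sqsubseteq>\<^bsub>L\<^esub> z; x \<in> carrier L; y \<in> carrier L; z \<in> carrier L\<rbrakk> \<Longrightarrow> x \<sqsubseteq>\<^bsub>L\<^esub> z"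
      by (blast intro: le_antisym le_trans)+
  qed (use j m c x in \<open>simp_all add: eq_is_equal meet_join_distrib\<close>)
  then show "complement L x \<in> carrier L" "x \<sqinter>\<^bsub>L\<^esub> complement L x = \<bottom>\<^bsub>L\<^esub>"
      "x \<squnion>\<^bsub>L\<^esub> complement L x = \<top>\<^bsub>L\<^esub>"
    using c[OF x] by auto
qed

section \<open>Subalgebras as record updates of the carrier\<close>

text \<open>Nonemptiness brings in bottom and top, as meet and join of a member with its
  complement.\<close>

definition boolean_subalgebra :: "'a gorder \<Rightarrow> 'a set \<Rightarrow> bool" where
  "boolean_subalgebra L S \<longleftrightarrow> S \<subseteq> carrier L \<and> S \<noteq> {} \<and>
     (\<forall>x\<in>S. \<forall>y\<in>S. x \<squnion>\<^bsub>L\<^esub> y \<in> S \<and> x \<sqinter>\<^bsub>L\<^esub> y \<in> S) \<and> (\<forall>x\<in>S. complement L x \<in> S)"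

text \<open>Joins and meets are bounds taken within the carrier, so shrinking it could change them;
  closure under the old operations is what preserves them.\<close>

lemma
  fixes L :: "'a gorder"
  assumes "boolean_lattice L" and S: "boolean_subalgebra L S"
  shows boolean_lattice_subalgebra: "boolean_lattice (L\<lparr>carrier := S\<rparr>)"
    and join_subalgebra: "\<And>x y. \<lbrakk>x \<in> S; y \<in> S\<rbrakk> \<Longrightarrow> x \<squnion>\<^bsub>L\<lparr>carrier := S\<rparr>\<^esub> y = x \<squnion>\<^bsub>L\<^esub> y"
    and meet_subalgebra: "\<And>x y. \<lbrakk>x \<in> S; y \<in> S\<rbrakk> \<Longrightarrow> x \<sqinter>\<^bsub>L\<lparr>carrier := S\<rparr>\<^esub> y = x \<sqinter>\<^bsub>L\<^esub> y"
    and complement_subalgebra: "\<And>x. x \<in> S \<Longrightarrow> complement (L\<lparr>carrier := S\<rparr>) x = complement L x"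
proof -
  interpret boolean_lattice L by fact
  have sub: "x \<in> carrier L" if "x \<in> S" for x
    using S that by (auto simp: boolean_subalgebra_def)
  obtain x where x: "x \<in> S"
    using S by (auto simp: boolean_subalgebra_def)
  have bot: "\<bottom>\<^bsub>L\<^esub> \<in> S" and top: "\<top>\<^bsub>L\<^esub> \<in> S"
    using S x meet_complement[OF assms(1) sub[OF x]] join_complement[OF assms(1) sub[OF x]]
    unfolding boolean_subalgebra_def by metis+
  have eq: "eq (L\<lparr>carrier := S\<rparr>) = (=)"
    by (simp add: eq_is_equal)
  have antisym: "x = y" if "x \<sqsubseteq>\<^bsub>L\<lparr>carrier := S\<rparr>\<^esub> y" "y \<sqsubseteq>\<^bsub>L\<lparr>carrier := S\<rparr>\<^esub> x"
      "x \<in> carrier (L\<lparr>carrier := S\<rparr>)" "y \<in> carrier (L\<lparr>carrier := S\<rparr>)" for x y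
    using that sub le_antisym[of x y] by simp
  have trans: "x \<sqsubseteq>\<^bsub>L\<lparr>carrier := S\<rparr>\<^esub> z"
    if "x \<sqsubseteq>\<^bsub>L\<lparr>carrier := S\<rparr>\<^esub> y" "y \<sqsubseteq>\<^bsub>L\<lparr>carrier := S\<rparr>\<^esub> z" "x \<in> carrier (L\<lparr>carrier := S\<rparr>)"
      "y \<in> carrier (L\<lparr>carrier := S\<rparr>)" "z \<in> carrier (L\<lparr>carrier := S\<rparr>)" for x y z
    using that sub le_trans[of x y z] by simp
  have j: "x \<squnion>\<^bsub>L\<^esub> y \<in> carrier (L\<lparr>carrier := S\<rparr>) \<and>
      (\<forall>z\<in>carrier (L\<lparr>carrier := S\<rparr>). x \<squnion>\<^bsub>L\<^esub> y \<sqsubseteq>\<^bsub>L\<lparr>carrier := S\<rparr>\<^esub> z \<longleftrightarrow>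
        x \<sqsubseteq>\<^bsub>L\<lparr>carrier := S\<rparr>\<^esub> z \<and> y \<sqsubseteq>\<^bsub>L\<lparr>carrier := S\<rparr>\<^esub> z)"
    if "x \<in> carrier (L\<lparr>carrier := S\<rparr>)" "y \<in> carrier (L\<lparr>carrier := S\<rparr>)" for x y
  proof -
    have xy: "x \<in> carrier L" "y \<in> carrier L" and xyS: "x \<squnion>\<^bsub>L\<^esub> y \<in> S"
      using that sub S by (auto simp: boolean_subalgebra_def)
    have "x \<squnion>\<^bsub>L\<^esub> y \<sqsubseteq>\<^bsub>L\<^esub> z \<longleftrightarrow> x \<sqsubseteq>\<^bsub>L\<^esub> z \<and> y \<sqsubseteq>\<^bsub>L\<^esub> z" if "z \<in> carrier L" for z
      using that xy join_left[of x y] join_right[of x y] by (metis join_closed join_le le_trans)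
    then show ?thesis
      using xyS sub by simp
  qed
  have m: "x \<sqinter>\<^bsub>L\<^esub> y \<in> carrier (L\<lparr>carrier := S\<rparr>) \<and>
      (\<forall>z\<in>carrier (L\<lparr>carrier := S\<rparr>). z \<sqsubseteq>\<^bsub>L\<lparr>carrier := S\<rparr>\<^esub> x \<sqinter>\<^bsub>L\<^esub> y \<longleftrightarrow>
        z \<sqsubseteq>\<^bsub>L\<lparr>carrier := S\<rparr>\<^esub> x \<and> z \<sqsubseteq>\<^bsub>L\<lparr>carrier := S\<rparr>\<^esub> y)"
    if "x \<in> carrier (L\<lparr>carrier := S\<rparr>)" "y \<in> carrier (L\<lparr>carrier := S\<rparr>)" for x y
  proof -
    have xy: "x \<in> carrier L" "y \<in> carrier L" and xyS: "x \<sqinter>\<^bsub>L\<^esub> y \<in> S"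
      using that sub S by (auto simp: boolean_subalgebra_def)
    have "z \<sqsubseteq>\<^bsub>L\<^esub> x \<sqinter>\<^bsub>L\<^esub> y \<longleftrightarrow> z \<sqsubseteq>\<^bsub>L\<^esub> x \<and> z \<sqsubseteq>\<^bsub>L\<^esub> y" if "z \<in> carrier L" for z
      using that xy meet_left[of x y] meet_right[of x y] by (metis meet_closed meet_le le_trans)
    then show ?thesis
      using xyS sub by simp
  qed
  have c: "complement L x \<in> carrier (L\<lparr>carrier := S\<rparr>) \<and> x \<sqinter>\<^bsub>L\<^esub> complement L x = \<bottom>\<^bsub>L\<^esub> \<and>
      x \<squnion>\<^bsub>L\<^esub> complement L x = \<top>\<^bsub>L\<^esub>" if "x \<in> carrier (L\<lparr>carrier := S\<rparr>)" for x
    using that sub S meet_complement[OF assms(1)] join_complement[OF assms(1)]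
    by (auto simp: boolean_subalgebra_def)
  note I = boolean_latticeI[where L = "L\<lparr>carrier := S\<rparr>" and j = "Lattice.join L" and
      m = "Lattice.meet L" and c = "complement L" and b = "\<bottom>\<^bsub>L\<^esub>" and t = "\<top>\<^bsub>L\<^esub>"]
  show "boolean_lattice (L\<lparr>carrier := S\<rparr>)"
    by (rule I(1)) (fact eq antisym trans j m c | simp add: bot top sub meet_join_distrib)+
  show "x \<squnion>\<^bsub>L\<lparr>carrier := S\<rparr>\<^esub> y = x \<squnion>\<^bsub>L\<^esub> y" if "x \<in> S" "y \<in> S" for x y
    by (rule I(2)) (fact eq antisym trans j m c | simp add: bot top sub meet_join_distrib that)+
  show "x \<sqinter>\<^bsub>L\<lparr>carrier := S\<rparr>\<^esub> y = x \<sqinter>\<^bsub>L\<^esub> y" if "x \<in> S" "y \<in> S" for x y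
    by (rule I(3)) (fact eq antisym trans j m c | simp add: bot top sub meet_join_distrib that)+
  show "complement (L\<lparr>carrier := S\<rparr>) x = complement L x" if "x \<in> S" for x
    by (rule I(6)) (fact eq antisym trans j m c | simp add: bot top sub meet_join_distrib that)+
qed

section \<open>Two-valued homomorphisms and consequences of free generation\<close>

text \<open>Homomorphisms to the two-element algebra, written as predicates so that values are
  compared by propositional reasoning.\<close>

definition truth_valuation :: "'a gorder \<Rightarrow> ('a \<Rightarrow> bool) \<Rightarrow> bool" where
  "truth_valuation L v \<longleftrightarrow>
     (\<forall>x\<in>carrier L. \<forall>y\<in>carrier L. v (x \<squnion>\<^bsub>L\<^esub> y) = (v x \<or> v y) \<and> v (x \<sqinter>\<^bsub>L\<^esub> y) = (v x \<and> v y)) \<and>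
     (\<forall>x\<in>carrier L. v (complement L x) = (\<not> v x))"

lemma
  assumes "truth_valuation L v" "x \<in> carrier L"
  shows truth_valuation_join: "y \<in> carrier L \<Longrightarrow> v (x \<squnion>\<^bsub>L\<^esub> y) = (v x \<or> v y)"
    and truth_valuation_meet: "y \<in> carrier L \<Longrightarrow> v (x \<sqinter>\<^bsub>L\<^esub> y) = (v x \<and> v y)"
    and truth_valuation_complement: "v (complement L x) = (\<not> v x)"
  using assms by (simp_all add: truth_valuation_def)

text \<open>The two-element target has to live in the type of \<open>L\<close>, so it is the
  subalgebra of bottom and top; nontriviality keeps the two apart.\<close>

lemma freely_generated_valuation:
  fixes L :: "'a gorder"
  assumes "boolean_lattice L" and nontrivial: "\<bottom>\<^bsub>L\<^esub> \<noteq> \<top>\<^bsub>L\<^esub>" and X: "freely_generated_by L X"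
  obtains v where "truth_valuation L v" "\<And>x. x \<in> X \<Longrightarrow> v x \<longleftrightarrow> x \<in> V"
proof -
  interpret boolean_lattice L by fact
  let ?S = "{\<bottom>\<^bsub>L\<^esub>, \<top>\<^bsub>L\<^esub>}"
  let ?M = "L\<lparr>carrier := ?S\<rparr>"
  have join: "\<bottom>\<^bsub>L\<^esub> \<squnion>\<^bsub>L\<^esub> x = x" "x \<squnion>\<^bsub>L\<^esub> \<bottom>\<^bsub>L\<^esub> = x" "\<top>\<^bsub>L\<^esub> \<squnion>\<^bsub>L\<^esub> x = \<top>\<^bsub>L\<^esub>" "x \<squnion>\<^bsub>L\<^esub> \<top>\<^bsub>L\<^esub> = \<top>\<^bsub>L\<^esub>"
    if "x \<in> carrier L" for x
    using that by (auto intro!: le_antisym join_le join_left join_right)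
  have meet: "\<bottom>\<^bsub>L\<^esub> \<sqinter>\<^bsub>L\<^esub> x = \<bottom>\<^bsub>L\<^esub>" "x \<sqinter>\<^bsub>L\<^esub> \<bottom>\<^bsub>L\<^esub> = \<bottom>\<^bsub>L\<^esub>" "\<top>\<^bsub>L\<^esub> \<sqinter>\<^bsub>L\<^esub> x = x" "x \<sqinter>\<^bsub>L\<^esub> \<top>\<^bsub>L\<^esub> = x"
    if "x \<in> carrier L" for x
    using that by (auto intro!: le_antisym meet_le meet_left meet_right)
  have compl: "complement L \<bottom>\<^bsub>L\<^esub> = \<top>\<^bsub>L\<^esub>" "complement L \<top>\<^bsub>L\<^esub> = \<bottom>\<^bsub>L\<^esub>"
    using join_complement[OF assms(1), of "\<bottom>\<^bsub>L\<^esub>"] meet_complement[OF assms(1), of "\<top>\<^bsub>L\<^esub>"]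
      join(1) meet(3) complement_closed[OF assms(1)] by auto
  have sub: "boolean_subalgebra L ?S"
    using join meet compl by (auto simp: boolean_subalgebra_def)
  let ?f = "\<lambda>x. if x \<in> V then \<top>\<^bsub>L\<^esub> else \<bottom>\<^bsub>L\<^esub>"
  have "?f \<in> X \<rightarrow> carrier ?M"
    by auto
  then obtain h where h: "h \<in> boolean_hom L ?M" "\<And>x. x \<in> X \<Longrightarrow> h x = ?f x"
    using X boolean_lattice_subalgebra[OF assms(1) sub] unfolding freely_generated_by_def by blast
  have hS: "h x = \<bottom>\<^bsub>L\<^esub> \<or> h x = \<top>\<^bsub>L\<^esub>" if "x \<in> carrier L" for x
    using h(1) that by (auto simp: boolean_hom_def)
  have "truth_valuation L (\<lambda>x. h x = \<top>\<^bsub>L\<^esub>)"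
    unfolding truth_valuation_def
  proof (intro conjI ballI)
    fix x y assume xy: "x \<in> carrier L" "y \<in> carrier L"
    have "h (x \<squnion>\<^bsub>L\<^esub> y) = h x \<squnion>\<^bsub>L\<^esub> h y" "h (x \<sqinter>\<^bsub>L\<^esub> y) = h x \<sqinter>\<^bsub>L\<^esub> h y"
      using h(1) xy hS[OF xy(1)] hS[OF xy(2)] join_subalgebra[OF assms(1) sub]
        meet_subalgebra[OF assms(1) sub]
      by (auto simp: boolean_hom_def)
    then show "(h (x \<squnion>\<^bsub>L\<^esub> y) = \<top>\<^bsub>L\<^esub>) = (h x = \<top>\<^bsub>L\<^esub> \<or> h y = \<top>\<^bsub>L\<^esub>)"
        "(h (x \<sqinter>\<^bsub>L\<^esub> y) = \<top>\<^bsub>L\<^esub>) = (h x = \<top>\<^bsub>L\<^esub> \<and> h y = \<top>\<^bsub>L\<^esub>)"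
      using hS[OF xy(1)] hS[OF xy(2)] nontrivial by (auto simp: join meet)
  next
    fix x assume x: "x \<in> carrier L"
    have "h (complement L x) = complement L (h x)"
      using h(1) x hS[OF x] complement_subalgebra[OF assms(1) sub] by (auto simp: boolean_hom_def)
    then show "(h (complement L x) = \<top>\<^bsub>L\<^esub>) = (h x \<noteq> \<top>\<^bsub>L\<^esub>)"
      using hS[OF x] nontrivial by (auto simp: compl)
  qed
  then show thesis
    using h(2) nontrivial by (intro that[of "\<lambda>x. h x = \<top>\<^bsub>L\<^esub>"]) auto
qed

text \<open>Extend the inclusion of \<open>X\<close> to a homomorphism into \<open>S\<close>. Read
  as an endomorphism of \<open>L\<close>, it agrees with the identity on \<open>X\<close>, so
  uniqueness equates the two and every element lies in \<open>S\<close>.\<close>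

lemma freely_generated_subalgebra:
  fixes L :: "'a gorder"
  assumes "boolean_lattice L" and X: "freely_generated_by L X" and S: "boolean_subalgebra L S" "X \<subseteq> S"
  shows "S = carrier L"
proof -
  interpret boolean_lattice L by fact
  let ?M = "L\<lparr>carrier := S\<rparr>"
  have SL: "S \<subseteq> carrier L"
    using S by (auto simp: boolean_subalgebra_def)
  have "id \<in> X \<rightarrow> carrier ?M"
    using S by auto
  then obtain h where h: "h \<in> boolean_hom L ?M \<inter> extensional (carrier L)"
      "\<And>x. x \<in> X \<Longrightarrow> h x = x"
    using X boolean_lattice_subalgebra[OF assms(1) S(1)] unfolding freely_generated_by_def by force
  have hS: "h x \<in> S" if "x \<in> carrier L" for x
    using h(1) that by (auto simp: boolean_hom_def)
  have hom: "h \<in> boolean_hom L L \<inter> extensional (carrier L)"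
    using h(1) hS SL join_subalgebra[OF assms(1) S(1)] meet_subalgebra[OF assms(1) S(1)]
      complement_subalgebra[OF assms(1) S(1)]
    by (auto simp: boolean_hom_def)
  \<comment> \<open>The identity is restricted because uniqueness holds among extensional
    maps.\<close>
  let ?i = "restrict id (carrier L)"
  have i: "?i \<in> boolean_hom L L \<inter> extensional (carrier L)"
    by (auto simp: boolean_hom_def complement_closed[OF assms(1)])
  have "id \<in> X \<rightarrow> carrier L"
    using SL S by auto
  then have "\<exists>!h. h \<in> boolean_hom L L \<inter> extensional (carrier L) \<and> (\<forall>x\<in>X. h x = id x)"
    using X assms(1) unfolding freely_generated_by_def by blast
  moreover have "\<forall>x\<in>X. h x = id x" "\<forall>x\<in>X. ?i x = id x"
    using h(2) SL S by auto
  ultimately have "h = ?i"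
    using hom i by blast
  then have "x \<in> S" if "x \<in> carrier L" for x
    using hS[OF that] that by simp
  then show ?thesis
    using SL by auto
qed

text \<open>The elements with a finite support form a subalgebra containing the generators: binary
  operations unite supports, complements keep them.\<close>

lemma freely_generated_finite_support:
  fixes L :: "'a gorder"
  assumes L: "boolean_lattice L" and X: "freely_generated_by L X" and a: "a \<in> carrier L"
  obtains F where "finite F" "F \<subseteq> X"
    "\<And>v w. \<lbrakk>truth_valuation L v; truth_valuation L w; \<And>x. x \<in> F \<Longrightarrow> v x = w x\<rbrakk> \<Longrightarrow> v a = w a"
proof -
  interpret boolean_lattice L by fact
  define supp where "supp F a \<longleftrightarrow> finite F \<and> F \<subseteq> X \<and>
    (\<forall>v w. truth_valuation L v \<and> truth_valuation L w \<and> (\<forall>x\<in>F. v x = w x) \<longrightarrow> v a = w a)" for F a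
  define S where "S = {a \<in> carrier L. \<exists>F. supp F a}"
  have XL: "X \<subseteq> carrier L"
    using X by (simp add: freely_generated_by_def)
  have valI: "supp F (x \<squnion>\<^bsub>L\<^esub> y) \<and> supp F (x \<sqinter>\<^bsub>L\<^esub> y)"
    if "supp F x" "supp F y" "x \<in> carrier L" "y \<in> carrier L" for F x y
    using that by (auto simp: supp_def truth_valuation_join truth_valuation_meet)
  have mono: "supp G x" if "supp F x" "F \<subseteq> G" "finite G" "G \<subseteq> X" for F G x
    using that unfolding supp_def by (simp add: subset_iff)
  have "boolean_subalgebra L S"
    unfolding boolean_subalgebra_def
  proof (intro conjI ballI)
    show "S \<subseteq> carrier L"
      by (auto simp: S_def)
    have "v \<top>\<^bsub>L\<^esub>" if "truth_valuation L v" for v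
    proof -
      have "v (\<top>\<^bsub>L\<^esub> \<squnion>\<^bsub>L\<^esub> complement L \<top>\<^bsub>L\<^esub>)"
        using that complement_closed[OF L, of "\<top>\<^bsub>L\<^esub>"]
        by (simp add: truth_valuation_join truth_valuation_complement)
      then show ?thesis
        using join_complement[OF L, of "\<top>\<^bsub>L\<^esub>"] by simp
    qed
    then have "supp {} \<top>\<^bsub>L\<^esub>"
      by (auto simp: supp_def)
    then show "S \<noteq> {}"
      by (auto simp: S_def)
  next
    fix x y assume "x \<in> S" "y \<in> S"
    then obtain F G where "supp F x" "supp G y" "x \<in> carrier L" "y \<in> carrier L"
      by (auto simp: S_def)
    then have "supp (F \<union> G) (x \<squnion>\<^bsub>L\<^esub> y) \<and> supp (F \<union> G) (x \<sqinter>\<^bsub>L\<^esub> y)"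
      by (intro valI) (auto intro: mono simp: supp_def)
    then show "x \<squnion>\<^bsub>L\<^esub> y \<in> S" "x \<sqinter>\<^bsub>L\<^esub> y \<in> S"
      using \<open>x \<in> carrier L\<close> \<open>y \<in> carrier L\<close> by (auto simp: S_def)
  next
    fix x assume "x \<in> S"
    then obtain F where F: "supp F x" and x: "x \<in> carrier L"
      by (auto simp: S_def)
    have "supp F (complement L x)"
      using F x by (auto simp: supp_def truth_valuation_complement)
    then show "complement L x \<in> S"
      using x complement_closed[OF L] by (auto simp: S_def)
  qed
  moreover have "X \<subseteq> S"
  proof
    fix x assume "x \<in> X"
    then have "supp {x} x"
      by (simp add: supp_def)
    then show "x \<in> S"
      using XL \<open>x \<in> X\<close> by (auto simp: S_def)
  qed
  ultimately have "a \<in> S"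
    using freely_generated_subalgebra[OF L X] a by blast
  then obtain F where "supp F a"
    by (auto simp: S_def)
  then show thesis
    by (intro that[of F]) (simp_all add: supp_def)
qed

section \<open>The quotient by a sigma-ideal\<close>

text \<open>\<open>J\<close> may contain sets outside \<open>B\<close>: a lifted ideal is closed
  under arbitrary subsets.\<close>

locale sigma_ideal = sigma_algebra \<Omega> B for \<Omega> :: "'a set" and B +
  fixes J :: "'a set set"
  assumes ideal_empty: "{} \<in> J"
    and ideal_mono: "\<And>X Y. \<lbrakk>X \<in> J; Y \<subseteq> X\<rbrakk> \<Longrightarrow> Y \<in> J"
    and ideal_UN: "\<And>X :: nat \<Rightarrow> 'a set. (\<And>n. X n \<in> J) \<Longrightarrow> (\<Union>n. X n) \<in> J"
begin

abbreviation Q :: "'a set set gorder" where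
  "Q \<equiv> quotient_algebra B J"

definition cls :: "'a set \<Rightarrow> 'a set set" where
  "cls X = {Y \<in> B. (X - Y) \<union> (Y - X) \<in> J}"

text \<open>Lattice operations must be functions of classes. Representatives provide such functions,
  and \<open>cls_rep_Un\<close>, \<open>cls_rep_Int\<close> and \<open>cls_rep_compl\<close> then
  remove the choice.\<close>

definition rep :: "'a set set \<Rightarrow> 'a set" where
  "rep P = (SOME X. X \<in> B \<and> cls X = P)"

lemma ideal_subset_Un:
  assumes "X \<in> J" "Y \<in> J" "Z \<subseteq> X \<union> Y"
  shows "Z \<in> J"
proof -
  let ?F = "\<lambda>n :: nat. if n = 0 then X else Y"
  have "(\<Union>n. ?F n) \<in> J"
    by (rule ideal_UN) (use assms in auto)
  moreover have "X \<union> Y \<subseteq> (\<Union>n. ?F n)"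
    using UN_upper[of 0 UNIV ?F] UN_upper[of 1 UNIV ?F] by simp
  ultimately show ?thesis
    using assms(3) by (meson ideal_mono subset_trans)
qed

lemma carrier_Q: "carrier Q = cls ` B"
  by (auto simp: quotient_algebra_def quotient_def cls_def)

lemma cls_eq_iff:
  assumes "X \<in> B" "Y \<in> B"
  shows "cls X = cls Y \<longleftrightarrow> X - Y \<in> J \<and> Y - X \<in> J"
proof
  assume "cls X = cls Y"
  moreover have "Y \<in> cls Y"
    using assms by (simp add: cls_def ideal_empty)
  ultimately have "Y \<in> cls X"
    by simp
  then have "(X - Y) \<union> (Y - X) \<in> J"
    by (simp add: cls_def)
  then show "X - Y \<in> J \<and> Y - X \<in> J"
    using ideal_mono by blast
next
  assume XY: "X - Y \<in> J \<and> Y - X \<in> J"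
  then have D: "(X - Y) \<union> (Y - X) \<in> J"
    by (auto intro: ideal_subset_Un[of "X - Y" "Y - X"])
  have "(X - Z) \<union> (Z - X) \<in> J \<longleftrightarrow> (Y - Z) \<union> (Z - Y) \<in> J" for Z
  proof
    assume "(X - Z) \<union> (Z - X) \<in> J"
    then show "(Y - Z) \<union> (Z - Y) \<in> J"
      by (rule ideal_subset_Un[OF D]) auto
  next
    assume "(Y - Z) \<union> (Z - Y) \<in> J"
    then show "(X - Z) \<union> (Z - X) \<in> J"
      by (rule ideal_subset_Un[OF D]) auto
  qed
  then show "cls X = cls Y"
    by (simp add: cls_def)
qed

lemma rep: "P \<in> carrier Q \<Longrightarrow> rep P \<in> B \<and> cls (rep P) = P"
  unfolding rep_def by (rule someI_ex) (auto simp: carrier_Q)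

lemma le_cls_iff:
  assumes "X \<in> B" "Y \<in> B"
  shows "cls X \<sqsubseteq>\<^bsub>Q\<^esub> cls Y \<longleftrightarrow> X - Y \<in> J"
proof
  assume "cls X \<sqsubseteq>\<^bsub>Q\<^esub> cls Y"
  then obtain X' Y' where X': "(X - X') \<union> (X' - X) \<in> J" and Y': "(Y - Y') \<union> (Y' - Y) \<in> J"
      and "X' - Y' \<in> J"
    by (auto simp: quotient_algebra_def cls_def)
  have "((X - X') \<union> (X' - X)) \<union> ((Y - Y') \<union> (Y' - Y)) \<in> J"
    by (rule ideal_subset_Un[OF X' Y']) simp
  then show "X - Y \<in> J"
    by (rule ideal_subset_Un[OF _ \<open>X' - Y' \<in> J\<close>]) auto
next
  assume "X - Y \<in> J"
  moreover have "X \<in> cls X" "Y \<in> cls Y"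
    using assms by (simp_all add: cls_def ideal_empty)
  ultimately show "cls X \<sqsubseteq>\<^bsub>Q\<^esub> cls Y"
    by (auto simp: quotient_algebra_def)
qed

lemma Diff_trans_ideal: "X - Z \<in> J" if "X - Y \<in> J" "Y - Z \<in> J"
  by (rule ideal_subset_Un[OF that]) auto

lemma Un_Diff_ideal: "(X \<union> Y) - Z \<in> J \<longleftrightarrow> X - Z \<in> J \<and> Y - Z \<in> J"
proof
  assume "(X \<union> Y) - Z \<in> J"
  then show "X - Z \<in> J \<and> Y - Z \<in> J"
    by (auto elim!: ideal_mono)
qed (auto intro: ideal_subset_Un[of "X - Z" "Y - Z"])

lemma Diff_Int_ideal: "Z - (X \<inter> Y) \<in> J \<longleftrightarrow> Z - X \<in> J \<and> Z - Y \<in> J"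
proof
  assume "Z - (X \<inter> Y) \<in> J"
  then show "Z - X \<in> J \<and> Z - Y \<in> J"
    by (auto elim!: ideal_mono)
qed (auto intro: ideal_subset_Un[of "Z - X" "Z - Y"])

lemma rep_cls:
  assumes "X \<in> B"
  shows "rep (cls X) \<in> B" "X - rep (cls X) \<in> J" "rep (cls X) - X \<in> J"
proof -
  have "rep (cls X) \<in> B \<and> cls (rep (cls X)) = cls X"
    using assms by (intro rep) (auto simp: carrier_Q)
  then show "rep (cls X) \<in> B" "X - rep (cls X) \<in> J" "rep (cls X) - X \<in> J"
    using cls_eq_iff[of "rep (cls X)" X] assms by auto
qed

lemma cls_rep_Un:
  assumes "X \<in> B" "Y \<in> B"
  shows "cls (rep (cls X) \<union> rep (cls Y)) = cls (X \<union> Y)"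
proof -
  note X = rep_cls[OF assms(1)] and Y = rep_cls[OF assms(2)]
  have "rep (cls X) \<union> rep (cls Y) - (X \<union> Y) \<in> J"
    by (rule ideal_subset_Un[OF X(3) Y(3)]) auto
  moreover have "X \<union> Y - (rep (cls X) \<union> rep (cls Y)) \<in> J"
    by (rule ideal_subset_Un[OF X(2) Y(2)]) auto
  ultimately show ?thesis
    using assms X(1) Y(1) by (simp add: cls_eq_iff Un Int)
qed

lemma cls_rep_Int:
  assumes "X \<in> B" "Y \<in> B"
  shows "cls (rep (cls X) \<inter> rep (cls Y)) = cls (X \<inter> Y)"
proof -
  note X = rep_cls[OF assms(1)] and Y = rep_cls[OF assms(2)]
  have "rep (cls X) \<inter> rep (cls Y) - (X \<inter> Y) \<in> J"
    by (rule ideal_subset_Un[OF X(3) Y(3)]) auto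
  moreover have "X \<inter> Y - (rep (cls X) \<inter> rep (cls Y)) \<in> J"
    by (rule ideal_subset_Un[OF X(2) Y(2)]) auto
  ultimately show ?thesis
    using assms X(1) Y(1) by (simp add: cls_eq_iff Un Int)
qed

lemma cls_rep_compl:
  assumes "X \<in> B"
  shows "cls (\<Omega> - rep (cls X)) = cls (\<Omega> - X)"
proof -
  note X = rep_cls[OF assms]
  have "(\<Omega> - rep (cls X)) - (\<Omega> - X) \<in> J"
    by (rule ideal_mono[OF X(2)]) auto
  moreover have "(\<Omega> - X) - (\<Omega> - rep (cls X)) \<in> J"
    by (rule ideal_mono[OF X(3)]) auto
  ultimately show ?thesis
    using assms X(1) by (simp add: cls_eq_iff compl_sets)
qed

lemma
  shows boolean_lattice_Q: "boolean_lattice Q"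
    and join_cls: "\<And>X Y. \<lbrakk>X \<in> B; Y \<in> B\<rbrakk> \<Longrightarrow> cls X \<squnion>\<^bsub>Q\<^esub> cls Y = cls (X \<union> Y)"
    and meet_cls: "\<And>X Y. \<lbrakk>X \<in> B; Y \<in> B\<rbrakk> \<Longrightarrow> cls X \<sqinter>\<^bsub>Q\<^esub> cls Y = cls (X \<inter> Y)"
    and bottom_Q: "\<bottom>\<^bsub>Q\<^esub> = cls {}" and top_Q: "\<top>\<^bsub>Q\<^esub> = cls \<Omega>"
    and complement_cls: "\<And>X. X \<in> B \<Longrightarrow> complement Q (cls X) = cls (\<Omega> - X)"
proof -
  let ?j = "\<lambda>P P'. cls (rep P \<union> rep P')" and ?m = "\<lambda>P P'. cls (rep P \<inter> rep P')"
    and ?c = "\<lambda>P. cls (\<Omega> - rep P)"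
  have sub: "X \<subseteq> \<Omega>" if "X \<in> B" for X
    using that sets_into_space by auto
  have eq: "eq Q = (=)"
    by (simp add: quotient_algebra_def)
  have refl: "P \<sqsubseteq>\<^bsub>Q\<^esub> P" if "P \<in> carrier Q" for P
    using that by (auto simp: carrier_Q le_cls_iff ideal_empty)
  have antisym: "P = P'" if "P \<sqsubseteq>\<^bsub>Q\<^esub> P'" "P' \<sqsubseteq>\<^bsub>Q\<^esub> P" and PP': "P \<in> carrier Q" "P' \<in> carrier Q" for P P'
  proof -
    obtain X Y where "X \<in> B" "Y \<in> B" "P = cls X" "P' = cls Y"
      using PP' by (auto simp: carrier_Q)
    then show ?thesis
      using that by (simp add: le_cls_iff cls_eq_iff)
  qed
  have trans: "P \<sqsubseteq>\<^bsub>Q\<^esub> R"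
    if "P \<sqsubseteq>\<^bsub>Q\<^esub> P'" "P' \<sqsubseteq>\<^bsub>Q\<^esub> R" "P \<in> carrier Q" "P' \<in> carrier Q" "R \<in> carrier Q" for P P' R
    using that by (auto simp: carrier_Q le_cls_iff intro: Diff_trans_ideal)
  have j: "?j P P' \<in> carrier Q \<and> (\<forall>R\<in>carrier Q. ?j P P' \<sqsubseteq>\<^bsub>Q\<^esub> R \<longleftrightarrow> P \<sqsubseteq>\<^bsub>Q\<^esub> R \<and> P' \<sqsubseteq>\<^bsub>Q\<^esub> R)"
    if "P \<in> carrier Q" "P' \<in> carrier Q" for P P'
    using that by (auto simp: carrier_Q cls_rep_Un le_cls_iff Un_Diff_ideal Un Int)
  have m: "?m P P' \<in> carrier Q \<and> (\<forall>R\<in>carrier Q. R \<sqsubseteq>\<^bsub>Q\<^esub> ?m P P' \<longleftrightarrow> R \<sqsubseteq>\<^bsub>Q\<^esub> P \<and> R \<sqsubseteq>\<^bsub>Q\<^esub> P')"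
    if "P \<in> carrier Q" "P' \<in> carrier Q" for P P'
    using that by (auto simp: carrier_Q cls_rep_Int le_cls_iff Diff_Int_ideal Un Int)
  have b: "cls {} \<in> carrier Q" "\<And>P. P \<in> carrier Q \<Longrightarrow> cls {} \<sqsubseteq>\<^bsub>Q\<^esub> P"
    by (auto simp: carrier_Q le_cls_iff ideal_empty)
  have Diff_top: "X - \<Omega> = {}" if "X \<in> B" for X
    using sub[OF that] by blast
  have t: "cls \<Omega> \<in> carrier Q" "\<And>P. P \<in> carrier Q \<Longrightarrow> P \<sqsubseteq>\<^bsub>Q\<^esub> cls \<Omega>"
    by (auto simp: carrier_Q le_cls_iff Diff_top ideal_empty)
  have distrib: "?m P (?j P' R) = ?j (?m P P') (?m P R)"
    if "P \<in> carrier Q" "P' \<in> carrier Q" "R \<in> carrier Q" for P P' R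
    using that by (auto simp: carrier_Q cls_rep_Un cls_rep_Int Int_Un_distrib Un Int)
  have c: "?c P \<in> carrier Q \<and> ?m P (?c P) = cls {} \<and> ?j P (?c P) = cls \<Omega>"
    if P: "P \<in> carrier Q" for P
  proof -
    obtain X where X: "X \<in> B" "P = cls X"
      using P by (auto simp: carrier_Q)
    moreover have "X \<inter> (\<Omega> - X) = {}" "X \<union> (\<Omega> - X) = \<Omega>"
      using sub[OF X(1)] by auto
    ultimately show ?thesis
      by (simp add: carrier_Q cls_rep_Un cls_rep_Int cls_rep_compl compl_sets)
  qed
  note I = boolean_latticeI[where L = Q and j = ?j and m = ?m and c = ?c and b = "cls {}"
      and t = "cls \<Omega>"]
  have cls_carrier: "cls X \<in> carrier Q" if "X \<in> B" for X
    using that by (simp add: carrier_Q)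
  show "boolean_lattice Q"
    by (rule I(1)) (fact eq refl antisym trans j m b t distrib c)+
  show "cls X \<squnion>\<^bsub>Q\<^esub> cls Y = cls (X \<union> Y)" if "X \<in> B" "Y \<in> B" for X Y
  proof -
    have "cls X \<squnion>\<^bsub>Q\<^esub> cls Y = ?j (cls X) (cls Y)"
      by (rule I(2)) (fact eq refl antisym trans j m b t distrib c cls_carrier[OF that(1)] cls_carrier[OF that(2)])+
    then show ?thesis
      using that by (simp add: cls_rep_Un)
  qed
  show "cls X \<sqinter>\<^bsub>Q\<^esub> cls Y = cls (X \<inter> Y)" if "X \<in> B" "Y \<in> B" for X Y
  proof -
    have "cls X \<sqinter>\<^bsub>Q\<^esub> cls Y = ?m (cls X) (cls Y)"
      by (rule I(3)) (fact eq refl antisym trans j m b t distrib c cls_carrier[OF that(1)] cls_carrier[OF that(2)])+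
    then show ?thesis
      using that by (simp add: cls_rep_Int)
  qed
  show "\<bottom>\<^bsub>Q\<^esub> = cls {}"
    by (rule I(4)) (fact eq refl antisym trans j m b t distrib c)+
  show "\<top>\<^bsub>Q\<^esub> = cls \<Omega>"
    by (rule I(5)) (fact eq refl antisym trans j m b t distrib c)+
  show "complement Q (cls X) = cls (\<Omega> - X)" if "X \<in> B" for X
  proof -
    have "complement Q (cls X) = ?c (cls X)"
      by (rule I(6)) (fact eq refl antisym trans j m b t distrib c cls_carrier[OF that])+
    then show ?thesis
      using that by (simp add: cls_rep_compl)
  qed
qed

end

section \<open>Half-spaces: Tukey maximality, atomlessness, failure of freeness\<close>

text \<open>In terms of classes, \<open>H_decide\<close> says that half-spaces at infinitely many
  coordinates, one side each, have no lower bound but bottom.\<close>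

locale coordinate_algebra = sigma_ideal \<Omega> B J for \<Omega> :: "'a set" and B J +
  fixes K :: "'k set" and H :: "'k \<Rightarrow> bool \<Rightarrow> 'a set"
  assumes proper: "\<Omega> \<notin> J"
    and infinite_K: "infinite K"
    and H_sets: "\<alpha> \<in> K \<Longrightarrow> H \<alpha> True \<in> B"
    and H_compl: "\<alpha> \<in> K \<Longrightarrow> H \<alpha> False = \<Omega> - H \<alpha> True"
    and H_decide: "\<lbrakk>A \<subseteq> K; infinite A; \<And>\<alpha>. \<alpha> \<in> A \<Longrightarrow> C - H \<alpha> (s \<alpha>) \<in> J; C \<in> B\<rbrakk> \<Longrightarrow> C \<in> J"
begin

lemma H_in_B: "\<alpha> \<in> K \<Longrightarrow> H \<alpha> b \<in> B"
  using H_sets H_compl by (cases b) (auto intro: compl_sets)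

text \<open>The cardinal bound gives each element \<open>P\<close> of the algebra its own coordinate
  and thus a member \<open>a P\<close> of \<open>U\<close>. \<open>f\<close> sends a finite set to a
  lower bound in \<open>U\<close> of the corresponding \<open>a P\<close>, and \<open>g\<close>
  sends \<open>u\<close> to all \<open>P\<close> with \<open>u\<close> below \<open>a P\<close>. The
  work lies in the finiteness of \<open>g u\<close>.\<close>

lemma tukey_maximal_ultrafilter:
  assumes U: "boolean_ultrafilter Q U" and card: "|carrier Q| \<le>o |K|"
  shows "tukey_maximal Q U"
proof -
  interpret boolean_lattice Q
    by (rule boolean_lattice_Q)
  have UQ: "U \<subseteq> carrier Q" and bot: "\<bottom>\<^bsub>Q\<^esub> \<notin> U" and top: "\<top>\<^bsub>Q\<^esub> \<in> U"
    and meet: "\<And>x y. \<lbrakk>x \<in> U; y \<in> U\<rbrakk> \<Longrightarrow> x \<sqinter>\<^bsub>Q\<^esub> y \<in> U"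
    and ultra: "\<And>x. x \<in> carrier Q \<Longrightarrow> x \<in> U \<or> complement Q x \<in> U"
    using U unfolding boolean_ultrafilter_def by blast+
  obtain \<iota> where \<iota>: "inj_on \<iota> (carrier Q)" "\<iota> ` carrier Q \<subseteq> K"
    using card_of_ordLeq[THEN iffD2, OF card] by blast
  \<comment> \<open>The side of each half-space that the ultrafilter chooses.\<close>
  define s where "s \<alpha> \<longleftrightarrow> cls (H \<alpha> True) \<in> U" for \<alpha>
  have H_U: "cls (H \<alpha> (s \<alpha>)) \<in> U" if "\<alpha> \<in> K" for \<alpha>
  proof (cases "s \<alpha>")
    case False
    then show ?thesis
      using ultra[of "cls (H \<alpha> True)"] that H_sets
      by (auto simp: s_def H_compl complement_cls carrier_Q)
  qed (simp add: s_def)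
  define a where "a P = cls (H (\<iota> P) (s (\<iota> P)))" for P
  have a_U: "a P \<in> U" if "P \<in> carrier Q" for P
    using H_U \<iota>(2) that by (auto simp: a_def)
  have "\<exists>u\<in>U. \<forall>P\<in>D. u \<sqsubseteq>\<^bsub>Q\<^esub> a P" if "D \<in> Fpow (carrier Q)" for D
  proof -
    have "finite D" "D \<subseteq> carrier Q"
      using that by (auto simp: Fpow_def)
    then show ?thesis
    proof (induction D)
      case empty
      then show ?case
        using top by blast
    next
      case (insert P D)
      then obtain u where u: "u \<in> U" "\<forall>P\<in>D. u \<sqsubseteq>\<^bsub>Q\<^esub> a P"
        by auto
      have aP: "a P \<in> U"
        using insert a_U by auto
      show ?case
      proof (intro bexI ballI)
        show "u \<sqinter>\<^bsub>Q\<^esub> a P \<in> U"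
          using u aP meet by blast
        fix P' assume P': "P' \<in> insert P D"
        have c: "u \<in> carrier Q" "a P \<in> carrier Q" "a P' \<in> carrier Q"
          using u(1) aP a_U[of P'] P' insert.prems UQ by auto
        show "u \<sqinter>\<^bsub>Q\<^esub> a P \<sqsubseteq>\<^bsub>Q\<^esub> a P'"
          using P' u c meet_left[of u "a P"] meet_right[of u "a P"]
          by (metis insertE le_trans meet_closed)
      qed
    qed
  qed
  then obtain f where f: "\<And>D. D \<in> Fpow (carrier Q) \<Longrightarrow> f D \<in> U"
      "\<And>D P. \<lbrakk>D \<in> Fpow (carrier Q); P \<in> D\<rbrakk> \<Longrightarrow> f D \<sqsubseteq>\<^bsub>Q\<^esub> a P"
    by metis
  define g where "g u = {P \<in> carrier Q. u \<sqsubseteq>\<^bsub>Q\<^esub> a P}" for u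
  have finite_g: "finite (g u)" if "u \<in> U" for u
  proof (rule ccontr)
    assume inf: "infinite (g u)"
    obtain C where C: "C \<in> B" "u = cls C"
      using \<open>u \<in> U\<close> UQ by (auto simp: carrier_Q)
    have gQ: "g u \<subseteq> carrier Q"
      by (auto simp: g_def)
    \<comment> \<open>Injectivity of \<open>\<iota>\<close> turns infinitely many elements of
      \<open>g u\<close> into infinitely many coordinates, as \<open>H_decide\<close>
      demands.\<close>
    have "C \<in> J"
    proof (rule H_decide)
      show "\<iota> ` g u \<subseteq> K"
        using gQ \<iota>(2) by blast
      show "infinite (\<iota> ` g u)"
        using inf gQ \<iota>(1) by (meson finite_image_iff inj_on_subset)
      show "C - H \<alpha> (s \<alpha>) \<in> J" if "\<alpha> \<in> \<iota> ` g u" for \<alpha>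
        using that C \<iota>(2) by (auto simp: g_def a_def le_cls_iff H_in_B image_subset_iff)
    qed (fact C)
    then have "u = \<bottom>\<^bsub>Q\<^esub>"
      using C by (simp add: bottom_Q cls_eq_iff ideal_empty)
    then show False
      using bot \<open>u \<in> U\<close> by simp
  qed
  show ?thesis
    unfolding tukey_maximal_def tukey_le_def finite_subsets_order_def
  proof (intro bexI[of _ f] bexI[of _ g])
    show "g \<in> carrier (inv_gorder (Q\<lparr>carrier := U\<rparr>)) \<rightarrow>
        carrier \<lparr>carrier = Fpow (carrier Q), eq = (=), le = (\<subseteq>)\<rparr>"
      using finite_g by (auto simp: Fpow_def g_def)
    show "f \<in> carrier \<lparr>carrier = Fpow (carrier Q), eq = (=), le = (\<subseteq>)\<rparr> \<rightarrow>
        carrier (inv_gorder (Q\<lparr>carrier := U\<rparr>))"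
      using f(1) by auto
    have "D \<subseteq> g u" if "D \<in> Fpow (carrier Q)" "u \<in> U" "u \<sqsubseteq>\<^bsub>Q\<^esub> f D" for D u
    proof
      fix P assume P: "P \<in> D"
      then have "P \<in> carrier Q"
        using that(1) by (auto simp: Fpow_def)
      then show "P \<in> g u"
        using le_trans[OF that(3) f(2)[OF that(1) P]] f(1)[OF that(1)] a_U[of P] that(2) UQ
        by (auto simp: g_def)
    qed
    then show "\<forall>d\<in>carrier \<lparr>carrier = Fpow (carrier Q), eq = (=), le = (\<subseteq>)\<rparr>.
        \<forall>e\<in>carrier (inv_gorder (Q\<lparr>carrier := U\<rparr>)). f d \<sqsubseteq>\<^bsub>inv_gorder (Q\<lparr>carrier := U\<rparr>)\<^esub> e \<longrightarrow>
          d \<sqsubseteq>\<^bsub>\<lparr>carrier = Fpow (carrier Q), eq = (=), le = (\<subseteq>)\<rparr>\<^esub> g e"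
      by simp
  qed
qed

text \<open>Atomlessness. A set that nothing splits lies, modulo \<open>J\<close>, on one side of
  every half-space; with these sides as \<open>s\<close>, \<open>H_decide\<close> puts it into
  \<open>J\<close>.\<close>

lemma splits:
  assumes "C \<in> B" "C \<notin> J"
  shows "\<exists>S\<in>B. C \<inter> S \<notin> J \<and> C - S \<notin> J"
proof (rule ccontr)
  assume "\<not> ?thesis"
  then have *: "C \<inter> S \<in> J \<or> C - S \<in> J" if "S \<in> B" for S
    using that by blast
  have "C \<in> J"
  proof (rule H_decide[of K C "\<lambda>\<alpha>. C - H \<alpha> True \<in> J"])
    fix \<alpha> assume "\<alpha> \<in> K"
    show "C - H \<alpha> (C - H \<alpha> True \<in> J) \<in> J"
    proof (cases "C - H \<alpha> True \<in> J")
      case False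
      then have "C \<inter> H \<alpha> True \<in> J"
        using * H_sets \<open>\<alpha> \<in> K\<close> by blast
      moreover have "C - H \<alpha> False \<subseteq> C \<inter> H \<alpha> True"
        using assms(1) sets_into_space \<open>\<alpha> \<in> K\<close> by (auto simp: H_compl)
      ultimately show ?thesis
        using False ideal_mono by auto
    qed simp
  qed (use infinite_K assms in auto)
  then show False
    using assms by simp
qed

text \<open>With finitely many classes, infinitely many half-spaces would share the class of one
  \<open>H \<beta> True\<close>. \<open>H_decide\<close> then puts this set into \<open>J\<close> by
  way of the sides \<open>True\<close>, and its complement by way of the sides
  \<open>False\<close>.\<close>

lemma infinite_carrier: "infinite (carrier Q)"
proof
  assume "finite (carrier Q)"
  moreover have "(\<lambda>\<alpha>. cls (H \<alpha> True)) ` K \<subseteq> carrier Q"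
    by (auto simp: carrier_Q H_sets)
  ultimately have "finite ((\<lambda>\<alpha>. cls (H \<alpha> True)) ` K)"
    by (rule rev_finite_subset)
  then obtain \<beta> where \<beta>: "\<beta> \<in> K" "infinite {\<alpha> \<in> K. cls (H \<alpha> True) = cls (H \<beta> True)}"
    using pigeonhole_infinite[OF infinite_K] by blast
  have eq: "H \<beta> True - H \<alpha> True \<in> J" "H \<alpha> True - H \<beta> True \<in> J"
    if "\<alpha> \<in> {\<alpha> \<in> K. cls (H \<alpha> True) = cls (H \<beta> True)}" for \<alpha>
    using that \<beta>(1) cls_eq_iff[of "H \<alpha> True" "H \<beta> True"] H_sets by auto
  have "H \<beta> True \<in> J"
    by (rule H_decide[OF _ \<beta>(2), where s = "\<lambda>_. True"]) (use \<beta>(1) eq H_sets in auto)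
  moreover have "\<Omega> - H \<beta> True \<in> J"
  proof (rule H_decide[OF _ \<beta>(2), where s = "\<lambda>_. False"])
    fix \<alpha> assume \<alpha>: "\<alpha> \<in> {\<alpha> \<in> K. cls (H \<alpha> True) = cls (H \<beta> True)}"
    show "\<Omega> - H \<beta> True - H \<alpha> False \<in> J"
      by (rule ideal_mono[OF eq(2)[OF \<alpha>]]) (use \<alpha> in \<open>auto simp: H_compl\<close>)
  qed (use \<beta>(1) H_sets in \<open>auto intro: compl_sets\<close>)
  ultimately have "\<Omega> \<in> J"
    by (rule ideal_subset_Un) auto
  then show False
    using proper by simp
qed

lemma not_free: "\<not> free_boolean_lattice Q"
proof
  assume "free_boolean_lattice Q"
  then obtain X where X: "freely_generated_by Q X"
    by (auto simp: free_boolean_lattice_def)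
  then have XQ: "X \<subseteq> carrier Q"
    by (simp add: freely_generated_by_def)
  have nontrivial: "\<bottom>\<^bsub>Q\<^esub> \<noteq> \<top>\<^bsub>Q\<^esub>"
    using proper by (simp add: bottom_Q top_Q cls_eq_iff)
  show False
  proof (cases "finite X")
    case True
    \<comment> \<open>Each generator cuts \<open>C\<close> into two pieces, one of them outside
      \<open>J\<close>. Keeping that piece decides the generator and preserves earlier decisions, so
      the final \<open>C\<close> behaves like an atom.\<close>
    have "\<exists>C\<in>B. C \<notin> J \<and> (\<forall>P\<in>X. C - rep P \<in> J \<or> C \<inter> rep P \<in> J)"
      using True XQ
    proof (induction X)
      case empty
      then show ?case
        using proper by blast
    next
      case (insert P X)
      then obtain C where C: "C \<in> B" "C \<notin> J" "\<forall>P\<in>X. C - rep P \<in> J \<or> C \<inter> rep P \<in> J"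
        by auto
      have P: "rep P \<in> B"
        using insert rep by auto
      have "C \<inter> rep P \<notin> J \<or> C - rep P \<notin> J"
        using C(2) ideal_subset_Un[of "C \<inter> rep P" "C - rep P" C] by blast
      then obtain D where D: "D \<in> B" "D \<notin> J" "D \<subseteq> C" "D - rep P \<in> J \<or> D \<inter> rep P \<in> J"
      proof
        assume "C \<inter> rep P \<notin> J"
        moreover have "C \<inter> rep P - rep P \<in> J"
          by (rule ideal_mono[OF ideal_empty]) auto
        ultimately show thesis
          using C(1) P by (intro that[of "C \<inter> rep P"]) blast+
      next
        assume "C - rep P \<notin> J"
        moreover have "(C - rep P) \<inter> rep P \<in> J"
          by (rule ideal_mono[OF ideal_empty]) auto
        ultimately show thesis
          using C(1) P by (intro that[of "C - rep P"]) blast+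
      qed
      have "D - rep P' \<in> J \<or> D \<inter> rep P' \<in> J" if "P' \<in> X" for P'
        using C(3) that D(3) ideal_mono[of "C - rep P'" "D - rep P'"]
          ideal_mono[of "C \<inter> rep P'" "D \<inter> rep P'"] by blast
      then show ?case
        using D by (intro bexI[of _ D]) blast+
    qed
    then obtain C where C: "C \<in> B" "C \<notin> J" "\<And>P. P \<in> X \<Longrightarrow> C - rep P \<in> J \<or> C \<inter> rep P \<in> J"
      by blast
    \<comment> \<open>The sets decided by \<open>C\<close>. Their classes form a subalgebra
      containing the generators, so \<open>C\<close> would decide every set, against
      \<open>splits\<close>.\<close>
    define T where "T = {S \<in> B. C - S \<in> J \<or> C \<inter> S \<in> J}"
    have T_compl: "\<Omega> - S \<in> T" if "S \<in> T" for S
    proof -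
      have "C - (\<Omega> - S) \<subseteq> C \<inter> S" "C \<inter> (\<Omega> - S) \<subseteq> C - S"
        using sets_into_space[OF C(1)] by auto
      then show ?thesis
        using that ideal_mono unfolding T_def by blast
    qed
    have T_Un: "S \<union> S' \<in> T" if SS': "S \<in> T" "S' \<in> T" for S S'
    proof -
      consider "C - S \<in> J" | "C - S' \<in> J" | "C \<inter> S \<in> J" "C \<inter> S' \<in> J"
        using SS' by (auto simp: T_def)
      then have "C - (S \<union> S') \<in> J \<or> C \<inter> (S \<union> S') \<in> J"
      proof cases
        case 1
        then show ?thesis
          using ideal_mono[of "C - S" "C - (S \<union> S')"] by blast
      next
        case 2
        then show ?thesis
          using ideal_mono[of "C - S'" "C - (S \<union> S')"] by blast
      next
        case 3
        then show ?thesis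
          using ideal_subset_Un[of "C \<inter> S" "C \<inter> S'" "C \<inter> (S \<union> S')"] by blast
      qed
      then show ?thesis
        using SS' by (auto simp: T_def)
    qed
    have T_Int: "S \<inter> S' \<in> T" if "S \<in> T" "S' \<in> T" for S S'
    proof -
      have "S \<inter> S' = \<Omega> - ((\<Omega> - S) \<union> (\<Omega> - S'))"
        using that sets_into_space by (auto simp: T_def)
      then show ?thesis
        using that T_compl T_Un by simp
    qed
    have TB: "T \<subseteq> B"
      by (auto simp: T_def)
    have "boolean_subalgebra Q (cls ` T)"
      unfolding boolean_subalgebra_def
    proof (intro conjI ballI)
      have "\<Omega> \<in> T"
        using sets_into_space[OF C(1)] ideal_empty by (auto simp: T_def Diff_eq_empty_iff[THEN iffD2])
      then show "cls ` T \<noteq> {}"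
        by blast
    qed (use TB in \<open>auto simp: carrier_Q join_cls meet_cls complement_cls subset_iff
           intro!: imageI T_Un T_Int T_compl\<close>)
    moreover have "X \<subseteq> cls ` T"
    proof
      fix P assume "P \<in> X"
      then have "rep P \<in> T" "P = cls (rep P)"
        using C(3) rep XQ by (auto simp: T_def)
      then show "P \<in> cls ` T"
        by blast
    qed
    ultimately have T: "cls ` T = carrier Q"
      by (rule freely_generated_subalgebra[OF boolean_lattice_Q X])
    obtain S where S: "S \<in> B" "C \<inter> S \<notin> J" "C - S \<notin> J"
      using splits[OF C(1,2)] by auto
    then have "cls S \<in> cls ` T"
      by (simp add: T carrier_Q)
    then obtain S' where S': "S' \<in> T" "cls S = cls S'"
      by auto
    then have "S - S' \<in> J" "S' - S \<in> J"
      using cls_eq_iff S(1) TB by blast+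
    moreover have "C - S' \<in> J \<or> C \<inter> S' \<in> J"
      using S'(1) by (simp add: T_def)
    ultimately show False
      using ideal_subset_Un[of "C - S'" "S' - S" "C - S"]
        ideal_subset_Un[of "C \<inter> S'" "S - S'" "C \<inter> S"] S(2,3) by blast
  next
    case False
    then obtain x :: "nat \<Rightarrow> 'a set set" where x: "inj x" "range x \<subseteq> X"
      using infinite_countable_subset by blast
    define Y where "Y n = rep (x n)" for n
    have Y: "Y n \<in> B" "cls (Y n) = x n" for n
      using rep[of "x n"] x(2) XQ by (auto simp: Y_def)
    define A where "A = (\<Union>n. disjointed Y (2 * n))"
    have "range (disjointed Y) \<subseteq> B"
      using Y(1) by (intro range_disjointed_sets) auto
    then have A: "A \<in> B"
      unfolding A_def by (intro countable_nat_UN) auto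
    obtain F where F: "finite F" "F \<subseteq> X"
      "\<And>v w. \<lbrakk>truth_valuation Q v; truth_valuation Q w; \<And>y. y \<in> F \<Longrightarrow> v y = w y\<rbrakk>
        \<Longrightarrow> v (cls A) = w (cls A)"
      using freely_generated_finite_support[OF boolean_lattice_Q X, of "cls A"] A
      by (auto simp: carrier_Q)
    have "finite (x -` F)"
      using F(1) x(1) by (simp add: finite_vimageI)
    \<comment> \<open>Both \<open>2 * N\<close> and \<open>Suc (2 * N)\<close> are at least
      \<open>N\<close>, so the support of \<open>A\<close> contains neither of these two generators
      of opposite parity.\<close>
    then obtain N where N: "\<And>n. n \<ge> N \<Longrightarrow> x n \<notin> F"
      by (metis finite_nat_set_iff_bounded not_le vimageI)
    have clsQ: "cls S \<in> carrier Q" if "S \<in> B" for S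
      using that by (simp add: carrier_Q)
    have v_Un: "v (cls (S \<union> S')) \<longleftrightarrow> v (cls S) \<or> v (cls S')"
      if "truth_valuation Q v" "S \<in> B" "S' \<in> B" for v S S'
      using truth_valuation_join[OF that(1) clsQ[OF that(2)] clsQ[OF that(3)]] that
      by (simp add: join_cls)
    have v_compl: "v (cls (\<Omega> - S)) \<longleftrightarrow> \<not> v (cls S)" if "truth_valuation Q v" "S \<in> B" for v S
      using truth_valuation_complement[OF that(1) clsQ[OF that(2)]] that by (simp add: complement_cls)
    have v_less: "\<not> v (cls (\<Union>i<n. Y i))"
      if v: "truth_valuation Q v" and Yv: "\<And>i. i < n \<Longrightarrow> \<not> v (x i)" for v n
      using Yv
    proof (induction n)
      case 0
      \<comment> \<open>The class of the empty set lies below that of \<open>\<Omega>\<close> and is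
        its complement, so no valuation holds there.\<close>
      show ?case
        using v_Un[OF v, of \<Omega> "{}"] v_compl[OF v, of \<Omega>] by simp
    next
      case (Suc n)
      have "(\<Union>i<n. Y i) \<in> B"
        using Y(1) by auto
      then have "v (cls (Y n \<union> (\<Union>i<n. Y i))) \<longleftrightarrow> v (x n) \<or> v (cls (\<Union>i<n. Y i))"
        using v_Un[OF v Y(1)[of n]] by (simp add: Y(2))
      then show ?case
        using Suc by (simp add: lessThan_Suc)
    qed
    have v_mono: "v (cls S) \<or> v (cls S')"
      if v: "truth_valuation Q v" and "v (cls R)" "R \<subseteq> S \<union> S'" "R \<in> B" "S \<in> B" "S' \<in> B" for v R S S'
      using that v_Un[OF v, of R "S \<union> S'"] v_Un[OF v, of S S'] by (simp add: Un Un_absorb1)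
    \<comment> \<open>\<open>v\<close> makes a single even-indexed generator true, \<open>w\<close>
      a single odd-indexed one. They agree on the support \<open>F\<close> but will differ on
      \<open>A\<close>.\<close>
    obtain v where v: "truth_valuation Q v" "\<And>y. y \<in> X \<Longrightarrow> v y \<longleftrightarrow> y \<in> {x (2 * N)}"
      using freely_generated_valuation[OF boolean_lattice_Q nontrivial X] by blast
    obtain w where w: "truth_valuation Q w" "\<And>y. y \<in> X \<Longrightarrow> w y \<longleftrightarrow> y \<in> {x (Suc (2 * N))}"
      using freely_generated_valuation[OF boolean_lattice_Q nontrivial X] by blast
    have vx: "v (x i) \<longleftrightarrow> i = 2 * N" and wx: "w (x i) \<longleftrightarrow> i = Suc (2 * N)" for i
      using v(2)[of "x i"] w(2)[of "x i"] x by (auto simp: inj_eq)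
    have U: "(\<Union>i<n. Y i) \<in> B" for n
      using Y(1) by auto
    have "disjointed Y (2 * N) \<subseteq> A"
      by (auto simp: A_def)
    \<comment> \<open>\<open>v\<close> need not respect the infinite union that defines
      \<open>A\<close>. It does respect this finite covering, where it fails on all earlier
      \<open>Y i\<close> and holds on \<open>Y (2 * N)\<close>, so it holds on
      \<open>A\<close>.\<close>
    then have "Y (2 * N) \<subseteq> A \<union> (\<Union>i<2 * N. Y i)"
      by (auto simp: disjointed_def)
    then have "v (cls A)"
      using v_mono[OF v(1), of "Y (2 * N)" A "\<Union>i<2 * N. Y i"] v_less[OF v(1), of "2 * N"] Y A U
      by (auto simp: vx)
    \<comment> \<open>The mirror image for \<open>w\<close>: by parity \<open>A\<close> misses the
      odd differences, so the complement of \<open>A\<close> takes its place in the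
      covering.\<close>
    have "disjointed Y (Suc (2 * N)) \<inter> disjointed Y (2 * n) = {}" for n
      using disjoint_family_disjointed[of Y] by (rule disjoint_family_onD) (rule UNIV_I | presburger)+
    then have "disjointed Y (Suc (2 * N)) \<inter> A = {}"
      by (auto simp: A_def)
    then have "Y (Suc (2 * N)) \<subseteq> (\<Omega> - A) \<union> (\<Union>i<Suc (2 * N). Y i)"
      using sets_into_space[OF Y(1)[of "Suc (2 * N)"]] by (auto simp: disjointed_def)
    then have "w (cls (\<Omega> - A))"
      using v_mono[OF w(1), of "Y (Suc (2 * N))" "\<Omega> - A" "\<Union>i<Suc (2 * N). Y i"]
        v_less[OF w(1), of "Suc (2 * N)"] Y A U
      by (auto simp: wx)
    then have "\<not> w (cls A)"
      using v_compl[OF w(1) A] by simp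
    have "v y = w y" if "y \<in> F" for y
    proof -
      have "y \<noteq> x (2 * N)" "y \<noteq> x (Suc (2 * N))"
        using that N[of "2 * N"] N[of "Suc (2 * N)"] by auto
      then show ?thesis
        using v(2) w(2) that F(2) by auto
    qed
    then show False
      using F(3)[OF v(1) w(1)] \<open>v (cls A)\<close> \<open>\<not> w (cls A)\<close> by blast
  qed
qed

end

section \<open>The number of sets in a generated sigma-algebra\<close>

text \<open>
  Codes for sets of the generated sigma-algebra: \<open>\<Phi>\<close> is going to be an injection of the sequences in
  a set \<open>K\<close> into \<open>K\<close>, so one element of \<open>K\<close> codes a tag \<open>t i\<close> together with countably many codes.
\<close>

inductive sigma_code ::
    "((nat \<Rightarrow> 'k) \<Rightarrow> 'k) \<Rightarrow> (nat \<Rightarrow> 'k) \<Rightarrow> ('a set \<Rightarrow> 'k) \<Rightarrow> 'a set \<Rightarrow> 'a set set \<Rightarrow> 'k \<Rightarrow> 'a set \<Rightarrow> bool"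
  for \<Phi> t \<gamma> \<Omega> G where
  basic: "A \<in> G \<Longrightarrow> sigma_code \<Phi> t \<gamma> \<Omega> G (\<Phi> (case_nat (t 0) (\<lambda>_. \<gamma> A))) A"
| empty: "sigma_code \<Phi> t \<gamma> \<Omega> G (\<Phi> (case_nat (t 1) (\<lambda>_. t 1))) {}"
| compl: "sigma_code \<Phi> t \<gamma> \<Omega> G c A \<Longrightarrow> sigma_code \<Phi> t \<gamma> \<Omega> G (\<Phi> (case_nat (t 2) (\<lambda>_. c))) (\<Omega> - A)"
| union: "(\<And>n. sigma_code \<Phi> t \<gamma> \<Omega> G (c n) (A n)) \<Longrightarrow>
            sigma_code \<Phi> t \<gamma> \<Omega> G (\<Phi> (case_nat (t 3) c)) (\<Union>n. A n)"

lemma sigma_code_exists: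
  assumes "S \<in> sigma_sets \<Omega> G"
  shows "\<exists>c. sigma_code \<Phi> t \<gamma> \<Omega> G c S"
  using assms
proof induction
  case (Union A)
  then obtain c where "\<And>n. sigma_code \<Phi> t \<gamma> \<Omega> G (c n) (A n)"
    by metis
  then show ?case
    by (blast intro: sigma_code.union)
qed (blast intro: sigma_code.intros)+

lemma case_nat_eq_iff: "case_nat a f = case_nat b g \<longleftrightarrow> a = b \<and> f = g"
  by (metis old.nat.simps(4) old.nat.simps(5) ext)

text \<open>A set may have many codes, but a code stands for only one set; hence choosing a code for
  every set is injective. The hypothesis on \<open>\<kappa> ^c natLeq\<close> is what packs a
  sequence of codes into a single one.\<close>

lemma card_of_sigma_sets:
  fixes \<kappa> :: "'k rel" and G :: "'a set set"
  assumes \<kappa>: "Cinfinite \<kappa>" and pow: "\<kappa> ^c natLeq \<le>o \<kappa>" and G: "|G| \<le>o \<kappa>"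
  shows "|sigma_sets \<Omega> G| \<le>o \<kappa>"
proof -
  let ?K = "Field \<kappa>"
  have K: "|?K| =o \<kappa>"
    using \<kappa> by (simp add: card_of_Field_ordIso)
  have "|Func (UNIV :: nat set) ?K| \<le>o |?K|"
    using ordLeq_ordIso_trans[OF pow ordIso_symmetric[OF K]] by (simp add: cexp_def Field_natLeq)
  then obtain \<Phi> where \<Phi>: "inj_on \<Phi> (Func (UNIV :: nat set) ?K)" "\<Phi> ` Func UNIV ?K \<subseteq> ?K"
    using card_of_ordLeq[of "Func (UNIV :: nat set) ?K" ?K] by auto
  obtain \<gamma> where \<gamma>: "inj_on \<gamma> G" "\<gamma> ` G \<subseteq> ?K"
    using card_of_ordLeq[of G ?K] ordLeq_ordIso_trans[OF G ordIso_symmetric[OF K]] by auto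
  obtain t :: "nat \<Rightarrow> 'k" where t: "inj t" "range t \<subseteq> ?K"
    using \<kappa> infinite_countable_subset[of ?K] by (auto simp: cinfinite_def)
  let ?R = "sigma_code \<Phi> t \<gamma> \<Omega> G"
  have tK: "t n \<in> ?K" for n
    using t(2) by auto
  have Func: "s \<in> Func (UNIV :: nat set) ?K" if "\<And>n. s n \<in> ?K" for s
    using that by (simp add: Func_def)
  have Func_case: "case_nat a f \<in> Func UNIV ?K" if "a \<in> ?K" "\<And>n. f n \<in> ?K" for a f
    using that by (intro Func) (simp split: nat.split)
  have inK: "c \<in> ?K" if "?R c S" for c S
    using that
  proof induction
    case (basic A)
    then show ?case
      using \<Phi>(2) \<gamma>(2) by (intro image_subset_iff[THEN iffD1, rule_format, OF \<Phi>(2)] Func_case tK) auto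
  qed (use tK in \<open>auto intro!: image_subset_iff[THEN iffD1, rule_format, OF \<Phi>(2)] Func_case\<close>)
  have \<Phi>_eq: "a = b \<and> f = g"
    if "\<Phi> (case_nat a f) = \<Phi> (case_nat b g)" "a \<in> ?K" "b \<in> ?K" "\<And>n. f n \<in> ?K" "\<And>n. g n \<in> ?K"
    for a b f g
    using inj_onD[OF \<Phi>(1) that(1) Func_case Func_case] that(2-) by (simp add: case_nat_eq_iff)
  have t_eq: "t m = t n \<longleftrightarrow> m = n" for m n
    using t(1) by (simp add: inj_eq)
  \<comment> \<open>Injectivity of \<open>\<Phi>\<close> recovers tag and arguments. Distinct tags
    exclude distinct constructors; for equal ones, injectivity of \<open>\<gamma>\<close> or the
    induction hypothesis applies.\<close>
  have unique: "S = S'" if "?R c S" "?R c S'" for c S S'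
    using that
  proof (induction arbitrary: S' rule: sigma_code.induct)
    case (basic A)
    have A: "\<gamma> A \<in> ?K"
      using basic.hyps \<gamma>(2) by auto
    from basic.prems show ?case
    proof cases
      case basic
      then have "\<gamma> A = \<gamma> S'"
        using \<Phi>_eq[OF basic(1)] A tK \<gamma>(2) by (auto simp: fun_eq_iff)
      then show ?thesis
        using \<gamma>(1) basic \<open>A \<in> G\<close> by (auto dest: inj_onD)
    next
      case empty
      then show ?thesis
        using \<Phi>_eq[OF empty(1)] A tK by (simp add: t_eq)
    next
      case (compl c' A')
      then show ?thesis
        using \<Phi>_eq[OF compl(1)] A tK inK[OF compl(3)] by (simp add: t_eq)
    next
      case (union c' A')
      then show ?thesis
        using \<Phi>_eq[OF union(1)] A tK inK[OF union(3)] by (simp add: t_eq)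
    qed
  next
    case empty
    from empty.prems show ?case
    proof cases
      case basic
      moreover have "\<gamma> S' \<in> ?K"
        using basic \<gamma>(2) by auto
      ultimately show ?thesis
        using \<Phi>_eq[OF basic(1)] tK by (simp add: t_eq)
    next
      case (compl c' A')
      then show ?thesis
        using \<Phi>_eq[OF compl(1)] tK inK[OF compl(3)] by (simp add: t_eq)
    next
      case (union c' A')
      then show ?thesis
        using \<Phi>_eq[OF union(1)] tK inK[OF union(3)] by (simp add: t_eq)
    qed simp
  next
    case (compl c A)
    have c: "c \<in> ?K"
      using compl.hyps inK by auto
    from compl.prems show ?case
    proof cases
      case basic
      moreover have "\<gamma> S' \<in> ?K"
        using basic \<gamma>(2) by auto
      ultimately show ?thesis
        using \<Phi>_eq[OF basic(1)] tK c by (simp add: t_eq)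
    next
      case empty
      then show ?thesis
        using \<Phi>_eq[OF empty(1)] c tK by (simp add: t_eq)
    next
      case (compl c' A')
      then have "c = c'"
        using \<Phi>_eq[OF compl(1)] tK inK[OF compl(3)] c by (auto simp: fun_eq_iff)
      then show ?thesis
        using compl compl.IH by blast
    next
      case (union c' A')
      then show ?thesis
        using \<Phi>_eq[OF union(1)] tK inK[OF union(3)] c by (simp add: t_eq)
    qed
  next
    case (union c A)
    have c: "c n \<in> ?K" for n
      using union.hyps inK by auto
    from union.prems show ?case
    proof cases
      case basic
      moreover have "\<gamma> S' \<in> ?K"
        using basic \<gamma>(2) by auto
      ultimately show ?thesis
        using \<Phi>_eq[OF basic(1)] tK c by (simp add: t_eq)
    next
      case empty
      then show ?thesis
        using \<Phi>_eq[OF empty(1)] c tK by (simp add: t_eq)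
    next
      case (compl c' A')
      then show ?thesis
        using \<Phi>_eq[OF compl(1)] tK inK[OF compl(3)] c by (simp add: t_eq)
    next
      case (union c' A')
      then have "c = c'"
        using \<Phi>_eq[OF union(1)] tK inK[OF union(3)] c by auto
      then show ?thesis
        using union union.IH by blast
    qed
  qed
  have "\<forall>S\<in>sigma_sets \<Omega> G. \<exists>c. ?R c S"
    using sigma_code_exists by blast
  then have "\<exists>code. \<forall>S\<in>sigma_sets \<Omega> G. ?R (code S) S"
    by (rule bchoice)
  then obtain code where code: "\<forall>S\<in>sigma_sets \<Omega> G. ?R (code S) S"
    by (rule exE)
  have "inj_on code (sigma_sets \<Omega> G)"
    by (rule inj_onI) (use code unique in metis)
  moreover have "code ` sigma_sets \<Omega> G \<subseteq> ?K"
    using code inK by blast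
  ultimately have "|sigma_sets \<Omega> G| \<le>o |?K|"
    using card_of_ordLeq by blast
  then show ?thesis
    using K ordLeq_ordIso_trans by blast
qed

section \<open>Cantor spaces and lifted ideals\<close>

lemma topspace_cantor_space [simp]: "topspace (cantor_space A) = A \<rightarrow>\<^sub>E UNIV"
  by (simp add: cantor_space_def)

lemma openin_cantor_space_iff:
  "openin (cantor_space A) S \<longleftrightarrow>
     (\<forall>x\<in>S. \<exists>U. finite {i \<in> A. U i \<noteq> UNIV} \<and> x \<in> Pi\<^sub>E A U \<and> Pi\<^sub>E A U \<subseteq> S)"
  by (simp add: cantor_space_def openin_product_topology_alt)

lemma openin_box: "finite {i \<in> A. U i \<noteq> UNIV} \<Longrightarrow> openin (cantor_space A) (Pi\<^sub>E A U)"
  by (auto simp: openin_cantor_space_iff)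

lemma compact_cantor_space: "compact_space (cantor_space A)"
  by (simp add: cantor_space_def compact_space_product_topology compact_space_discrete_topology)

lemma Hausdorff_cantor_space: "Hausdorff_space (cantor_space A)"
  by (simp add: cantor_space_def Hausdorff_space_product_topology)

lemma clopen_halfspace:
  assumes "\<alpha> \<in> A"
  shows "openin (cantor_space A) {f \<in> A \<rightarrow>\<^sub>E UNIV. f \<alpha> = b}"
    and "closedin (cantor_space A) {f \<in> A \<rightarrow>\<^sub>E UNIV. f \<alpha> = b}"
proof -
  have "continuous_map (cantor_space A) (discrete_topology UNIV) (\<lambda>f. f \<alpha>)"
    unfolding cantor_space_def using assms by (rule continuous_map_product_projection)
  then show "openin (cantor_space A) {f \<in> A \<rightarrow>\<^sub>E UNIV. f \<alpha> = b}"
      "closedin (cantor_space A) {f \<in> A \<rightarrow>\<^sub>E UNIV. f \<alpha> = b}"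
    using openin_continuous_map_preimage[of _ _ _ "{b}"]
      closedin_continuous_map_preimage[of _ _ _ "{b}"] by fastforce+
qed

text \<open>For counting, the clopen generators are replaced by one half-space per coordinate. A
  clopen set is a union of boxes because it is open, and finitely many suffice because it is
  compact.\<close>

lemma clopen_sigma_algebra_subset:
  "clopen_sigma_algebra A \<subseteq> sigma_sets (A \<rightarrow>\<^sub>E UNIV) ((\<lambda>\<alpha>. {f \<in> A \<rightarrow>\<^sub>E UNIV. f \<alpha>}) ` A)"
proof -
  let ?\<Omega> = "A \<rightarrow>\<^sub>E (UNIV :: bool set)"
  let ?M = "sigma_sets ?\<Omega> ((\<lambda>\<alpha>. {f \<in> ?\<Omega>. f \<alpha>}) ` A)"
  interpret sigma_algebra ?\<Omega> ?M
    by (rule sigma_algebra_sigma_sets) auto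
  have half: "{f \<in> ?\<Omega>. f \<alpha> \<in> V} \<in> ?M" if "\<alpha> \<in> A" for \<alpha> V
  proof -
    have T: "{f \<in> ?\<Omega>. f \<alpha>} \<in> ?M"
      using that by auto
    have "f \<alpha> \<in> V \<longleftrightarrow> f \<alpha> \<and> True \<in> V \<or> \<not> f \<alpha> \<and> False \<in> V" for f
      by (cases "f \<alpha>") auto
    then show ?thesis
      by (simp only:)
        (intro sets_Collect_disj sets_Collect_conj sets_Collect_neg sets_Collect_const T)
  qed
  have box: "Pi\<^sub>E A U \<in> ?M" if "finite {i \<in> A. U i \<noteq> UNIV}" for U
  proof -
    have "Pi\<^sub>E A U = {f \<in> ?\<Omega>. \<forall>i\<in>{i \<in> A. U i \<noteq> UNIV}. f i \<in> U i}"
    proof (intro equalityI subsetI)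
      fix f assume f: "f \<in> {f \<in> ?\<Omega>. \<forall>i\<in>{i \<in> A. U i \<noteq> UNIV}. f i \<in> U i}"
      have "f i \<in> U i" if "i \<in> A" for i
        using f that by (cases "U i = UNIV") simp_all
      then show "f \<in> Pi\<^sub>E A U"
        using f by (simp add: PiE_iff)
    qed (simp add: PiE_iff)
    also have "\<dots> \<in> ?M"
      by (rule sets_Collect_finite_All) (use half that in auto)
    finally show ?thesis .
  qed
  have "C \<in> ?M" if open_C: "openin (cantor_space A) C" and closed_C: "closedin (cantor_space A) C" for C
  proof -
    let ?\<U> = "{V. V \<subseteq> C \<and> (\<exists>U. V = Pi\<^sub>E A U \<and> finite {i \<in> A. U i \<noteq> UNIV})}"
    have "compactin (cantor_space A) C"
      using closed_C compact_cantor_space closedin_compact_space by blast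
    moreover have "\<And>V. V \<in> ?\<U> \<Longrightarrow> openin (cantor_space A) V"
      using openin_box by blast
    moreover have "C \<subseteq> \<Union>?\<U>"
    proof
      fix x assume "x \<in> C"
      with open_C obtain U where "finite {i \<in> A. U i \<noteq> UNIV}" "x \<in> Pi\<^sub>E A U" "Pi\<^sub>E A U \<subseteq> C"
        unfolding openin_cantor_space_iff by meson
      then show "x \<in> \<Union>?\<U>"
        by (intro UnionI[of "Pi\<^sub>E A U"]) auto
    qed
    ultimately have "\<exists>\<F>. finite \<F> \<and> \<F> \<subseteq> ?\<U> \<and> C \<subseteq> \<Union>\<F>"
      by (rule compactinD)
    then obtain \<F> where \<F>: "finite \<F>" "\<F> \<subseteq> ?\<U>" "C \<subseteq> \<Union>\<F>"
      by (elim exE conjE)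
    then have "C = \<Union>\<F>"
      by blast
    moreover have "\<F> \<subseteq> ?M"
      using \<F>(2) box by blast
    ultimately show ?thesis
      using \<F>(1) by auto
  qed
  then show ?thesis
    unfolding clopen_sigma_algebra_def topspace_cantor_space by (intro sigma_sets_mono) blast
qed

lemma card_clopen_sigma_algebra:
  fixes \<kappa> :: "'k rel"
  assumes "Cinfinite \<kappa>" "\<kappa> ^c natLeq \<le>o \<kappa>"
  shows "|clopen_sigma_algebra (Field \<kappa>)| \<le>o \<kappa>"
proof -
  let ?G = "(\<lambda>\<alpha>. {f \<in> Field \<kappa> \<rightarrow>\<^sub>E (UNIV :: bool set). f \<alpha>}) ` Field \<kappa>"
  have "|?G| \<le>o |Field \<kappa>|"
    by (rule card_of_image)
  then have "|?G| \<le>o \<kappa>"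
    using assms(1) card_of_Field_ordIso ordLeq_ordIso_trans by blast
  then have "|sigma_sets (Field \<kappa> \<rightarrow>\<^sub>E UNIV) ?G| \<le>o \<kappa>"
    by (rule card_of_sigma_sets[OF assms])
  then show ?thesis
    using card_of_mono1[OF clopen_sigma_algebra_subset] ordLeq_transitive by blast
qed

lemma lift_ideal_mono: "\<lbrakk>X \<in> lift_ideal I A; Y \<subseteq> X\<rbrakk> \<Longrightarrow> Y \<in> lift_ideal I A"
  unfolding lift_ideal_def by blast

section \<open>From ideals on the countable Cantor space to their lifts\<close>

text \<open>The common ground of the meagre and the null ideal. \<open>reindex_in\<close> allows a
  passage from a countable set of coordinates to a larger one.\<close>

locale cantor_ideal =
  fixes I :: "(nat \<Rightarrow> bool) set set"
  assumes UN_in: "\<And>Y :: nat \<Rightarrow> (nat \<Rightarrow> bool) set. (\<And>n. Y n \<in> I) \<Longrightarrow> (\<Union>n. Y n) \<in> I"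
    and reindex_in: "\<And>Y \<sigma>. \<lbrakk>Y \<in> I; inj \<sigma>\<rbrakk> \<Longrightarrow> {f. f \<circ> \<sigma> \<in> Y} \<in> I"
    and singleton_in: "\<And>x. {x} \<in> I"
    and UNIV_not_in: "UNIV \<notin> I"
begin

text \<open>The ranges of all \<open>\<Delta> n\<close> form a countable set with one enumeration
  \<open>e\<close>. Each \<open>\<Delta> n\<close> factors as \<open>e \<circ> \<sigma> n\<close>
  with \<open>\<sigma> n\<close> injective, so every \<open>Y n\<close> can be pulled back to the
  coordinates of \<open>e\<close>, where the union stays in \<open>I\<close>.\<close>

lemma lift_ideal_UN:
  fixes X :: "nat \<Rightarrow> ('k \<Rightarrow> bool) set"
  assumes "\<And>n. X n \<in> lift_ideal I A"
  shows "(\<Union>n. X n) \<in> lift_ideal I A"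
proof -
  have "\<forall>n. \<exists>\<Delta> :: nat \<Rightarrow> 'k. \<exists>Y\<in>I. inj \<Delta> \<and> range \<Delta> \<subseteq> A \<and> (\<forall>f\<in>X n. f \<circ> \<Delta> \<in> Y)"
    using assms by (simp add: lift_ideal_def)
  then obtain \<Delta> :: "nat \<Rightarrow> nat \<Rightarrow> 'k" and Y where \<Delta>: "\<And>n. Y n \<in> I" "\<And>n. inj (\<Delta> n)"
      "\<And>n. range (\<Delta> n) \<subseteq> A" "\<And>n f. f \<in> X n \<Longrightarrow> f \<circ> \<Delta> n \<in> Y n"
    by metis
  define R where "R = (\<Union>n. range (\<Delta> n))"
  have "infinite (range (\<Delta> 0))"
    using \<Delta>(2) range_inj_infinite by blast
  then have "infinite R"
    unfolding R_def by (meson UNIV_I UN_upper finite_subset)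
  moreover have "countable R"
    by (simp add: R_def)
  ultimately have e: "bij_betw (from_nat_into R) UNIV R"
    by (rule bij_betw_from_nat_into[rotated])
  define e where "e = from_nat_into R"
  define \<sigma> where "\<sigma> n k = to_nat_on R (\<Delta> n k)" for n k
  have e\<sigma>: "e \<circ> \<sigma> n = \<Delta> n" for n
    using \<open>countable R\<close> by (auto simp: e_def \<sigma>_def R_def fun_eq_iff intro!: from_nat_into_to_nat_on)
  have inj_\<sigma>: "inj (\<sigma> n)" for n
    using \<Delta>(2)[of n] unfolding e\<sigma>[symmetric] by (rule inj_on_imageI2)
  define Z where "Z = (\<Union>n. {g. g \<circ> \<sigma> n \<in> Y n})"
  have "Z \<in> I"
    unfolding Z_def by (intro UN_in reindex_in \<Delta>(1) inj_\<sigma>)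
  moreover have "inj e" "range e \<subseteq> A"
    using e \<Delta>(3) by (auto simp: e_def bij_betw_def R_def)
  moreover have "f \<circ> e \<in> Z" if "f \<in> (\<Union>n. X n)" for f
    using that \<Delta>(4) by (auto simp: Z_def comp_assoc e\<sigma>)
  moreover have "(\<Union>n. X n) \<subseteq> topspace (cantor_space A)"
    using assms unfolding lift_ideal_def by blast
  ultimately show ?thesis
    unfolding lift_ideal_def by blast
qed

lemma coordinate_algebra_ideal_algebra:
  assumes A: "infinite A"
  shows "coordinate_algebra (A \<rightarrow>\<^sub>E UNIV) (clopen_sigma_algebra A) (lift_ideal I A) A
           (\<lambda>\<alpha> b. {f \<in> A \<rightarrow>\<^sub>E UNIV. f \<alpha> = b})"
proof -
  let ?\<Omega> = "A \<rightarrow>\<^sub>E (UNIV :: bool set)"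
  have "sigma_algebra (topspace (cantor_space A)) (clopen_sigma_algebra A)"
    unfolding clopen_sigma_algebra_def by (rule sigma_algebra_sigma_sets) (blast dest: openin_subset)
  then interpret sigma_algebra ?\<Omega> "clopen_sigma_algebra A"
    by simp
  obtain \<Delta> :: "nat \<Rightarrow> 'a" where \<Delta>: "inj \<Delta>" "range \<Delta> \<subseteq> A"
    using infinite_countable_subset[OF A] by auto
  show ?thesis
  proof
    show "{} \<in> lift_ideal I A"
      using \<Delta> singleton_in by (simp add: lift_ideal_def) blast
    show "Y \<in> lift_ideal I A" if "X \<in> lift_ideal I A" "Y \<subseteq> X" for X Y
      using that by (rule lift_ideal_mono)
    show "(\<Union>n. X n) \<in> lift_ideal I A" if "\<And>n. X n \<in> lift_ideal I A" for X :: "nat \<Rightarrow> _"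
      using that by (rule lift_ideal_UN)
    show "?\<Omega> \<notin> lift_ideal I A"
    proof
      assume "?\<Omega> \<in> lift_ideal I A"
      then obtain \<Delta> :: "nat \<Rightarrow> 'a" and Y where Y: "Y \<in> I" "inj \<Delta>" "range \<Delta> \<subseteq> A"
          "\<And>f. f \<in> ?\<Omega> \<Longrightarrow> f \<circ> \<Delta> \<in> Y"
        by (auto simp: lift_ideal_def)
      have "g \<in> Y" for g
      proof -
        \<comment> \<open>Every sequence \<open>g\<close> is read along \<open>\<Delta>\<close> from
          some point of the space, so \<open>Y\<close> would be everything.\<close>
        have "restrict (g \<circ> inv \<Delta>) A \<circ> \<Delta> = g"
          using Y(2,3) by (auto simp: fun_eq_iff)
        moreover have "restrict (g \<circ> inv \<Delta>) A \<in> ?\<Omega>"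
          by auto
        ultimately show ?thesis
          using Y(4) by metis
      qed
      then have "Y = UNIV"
        by blast
      then show False
        using Y(1) UNIV_not_in by simp
    qed
    show "{f \<in> ?\<Omega>. f \<alpha> = True} \<in> clopen_sigma_algebra A" if "\<alpha> \<in> A" for \<alpha>
      unfolding clopen_sigma_algebra_def
      by (rule sigma_sets.Basic) (use clopen_halfspace[OF that, of True] in simp)
    show "C \<in> lift_ideal I A"
      if S: "S \<subseteq> A" "infinite S" and C: "C \<in> clopen_sigma_algebra A"
        and small: "\<And>\<alpha>. \<alpha> \<in> S \<Longrightarrow> C - {f \<in> ?\<Omega>. f \<alpha> = s \<alpha>} \<in> lift_ideal I A" for S C s
    proof -
      obtain \<Delta> :: "nat \<Rightarrow> 'a" where \<Delta>: "inj \<Delta>" "range \<Delta> \<subseteq> S"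
        using infinite_countable_subset[OF S(2)] by auto
      define D where "D n = (case n of 0 \<Rightarrow> {f \<in> ?\<Omega>. f \<circ> \<Delta> = s \<circ> \<Delta>}
        | Suc n \<Rightarrow> C - {f \<in> ?\<Omega>. f (\<Delta> n) = s (\<Delta> n)})" for n
      have "D n \<in> lift_ideal I A" for n
      proof (cases n)
        case 0
        then show ?thesis
          using \<Delta> S(1) singleton_in[of "s \<circ> \<Delta>"] unfolding D_def lift_ideal_def by force
      next
        case (Suc m)
        then show ?thesis
          using small[of "\<Delta> m"] \<Delta>(2) by (auto simp: D_def)
      qed
      then have "(\<Union>n. D n) \<in> lift_ideal I A"
        by (rule lift_ideal_UN)
      moreover have "C \<subseteq> (\<Union>n. D n)"
      proof
        fix f assume f: "f \<in> C"
        then have "f \<in> ?\<Omega>"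
          using sets_into_space[OF C] by auto
        show "f \<in> (\<Union>n. D n)"
        proof (cases "f \<circ> \<Delta> = s \<circ> \<Delta>")
          case True
          then have "f \<in> D 0"
            using \<open>f \<in> ?\<Omega>\<close> by (simp add: D_def)
          then show ?thesis
            by blast
        next
          case False
          then obtain m where "f (\<Delta> m) \<noteq> s (\<Delta> m)"
            by (auto simp: fun_eq_iff)
          then have "f \<in> D (Suc m)"
            using f by (simp add: D_def)
          then show ?thesis
            by blast
        qed
      qed
      ultimately show ?thesis
        by (rule lift_ideal_mono)
    qed
  qed (use A in auto)
qed

end

section \<open>The meagre and the null ideal\<close>

text \<open>Composition with an injection is continuous and open. Continuity keeps the preimage of
  the closure of \<open>N\<close> closed; openness would carry a nonempty open subset of that
  preimage to one inside the closure.\<close>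

lemma nowhere_dense_reindex:
  fixes \<sigma> :: "nat \<Rightarrow> nat"
  assumes "inj \<sigma>" and N: "nowhere_dense_in (cantor_space UNIV) N"
  shows "nowhere_dense_in (cantor_space UNIV) {f. f \<circ> \<sigma> \<in> N}"
proof -
  let ?T = "cantor_space (UNIV :: nat set)" and ?r = "\<lambda>f :: nat \<Rightarrow> bool. f \<circ> \<sigma>"
  have "continuous_map ?T (discrete_topology UNIV) (\<lambda>f. f (\<sigma> i))" for i
    unfolding cantor_space_def by (rule continuous_map_product_projection) simp
  then have cont: "continuous_map ?T ?T ?r"
    by (simp add: cantor_space_def continuous_map_componentwise_UNIV)
  have "closedin ?T (?T closure_of N)"
    by simp
  then have closed: "closedin ?T {f. ?r f \<in> ?T closure_of N}"
    using closedin_continuous_map_preimage[OF cont] by simp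
  have "{f. ?r f \<in> N} \<subseteq> {f. ?r f \<in> ?T closure_of N}"
    using N closure_of_subset[of N ?T] by (auto simp: nowhere_dense_in_def)
  then have closure: "?T closure_of {f. ?r f \<in> N} \<subseteq> {f. ?r f \<in> ?T closure_of N}"
    using closed by (rule closure_of_minimal)
  have False if W: "openin ?T W" "W \<subseteq> {f. ?r f \<in> ?T closure_of N}" and f: "f \<in> W" for W f
  proof -
    obtain U where U: "finite {i. U i \<noteq> UNIV}" "f \<in> Pi\<^sub>E UNIV U" "Pi\<^sub>E UNIV U \<subseteq> W"
      using W(1) f unfolding openin_cantor_space_iff by auto
    let ?V = "Pi\<^sub>E UNIV (\<lambda>j. U (\<sigma> j))"
    \<comment> \<open>Injectivity keeps the number of restricted coordinates finite.\<close>
    have "finite (\<sigma> -` {i. U i \<noteq> UNIV})"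
      using U(1) assms(1) by (rule finite_vimageI)
    then have V: "openin ?T ?V"
      by (intro openin_box) (simp add: vimage_def)
    have "g \<in> ?T closure_of N" if g: "g \<in> ?V" for g
    proof -
      \<comment> \<open>A lift of \<open>g\<close> into the box around \<open>f\<close>:
        \<open>g\<close> on the range of \<open>\<sigma>\<close>, \<open>f\<close>
        elsewhere.\<close>
      define h where "h i = (if i \<in> range \<sigma> then g (inv \<sigma> i) else f i)" for i
      have "h i \<in> U i" for i
      proof (cases "i \<in> range \<sigma>")
        case True
        then obtain j where "i = \<sigma> j"
          by auto
        then show ?thesis
          using g assms(1) by (simp add: h_def PiE_iff)
      next
        case False
        then show ?thesis
          using U(2) by (simp add: h_def PiE_iff)
      qed
      then have "h \<in> W"
        using U(3) by (auto simp: PiE_iff)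
      moreover have "?r h = g"
        using assms(1) by (auto simp: h_def)
      ultimately show ?thesis
        using W(2) by blast
    qed
    then have "?V \<subseteq> ?T interior_of (?T closure_of N)"
      using V by (intro interior_of_maximal) auto
    moreover have "?r f \<in> ?V"
      using U(2) by (simp add: PiE_iff)
    ultimately show False
      using N by (auto simp: nowhere_dense_in_def)
  qed
  then have "?T interior_of (?T closure_of {f. ?r f \<in> N}) = {}"
    using closure openin_interior_of[of ?T] interior_of_subset[of ?T] by (meson equals0I subset_trans)
  then show ?thesis
    by (simp add: nowhere_dense_in_def)
qed

text \<open>A basic box leaves some coordinate free, and flipping it yields a second point.\<close>

lemma nowhere_dense_singleton: "nowhere_dense_in (cantor_space (UNIV :: nat set)) {x}"
proof -
  let ?T = "cantor_space (UNIV :: nat set)"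
  have closed: "closedin ?T {x}"
    using Hausdorff_cantor_space[of "UNIV :: nat set"] by (simp add: closedin_Hausdorff_sing_eq)
  have "\<not> openin ?T {x}"
  proof
    assume "openin ?T {x}"
    then obtain U where U: "finite {i. U i \<noteq> UNIV}" "x \<in> Pi\<^sub>E UNIV U" "Pi\<^sub>E UNIV U \<subseteq> {x}"
      unfolding openin_cantor_space_iff by auto
    obtain i where i: "U i = UNIV"
      using ex_new_if_finite[OF infinite_UNIV_nat U(1)] by auto
    have "x(i := \<not> x i) \<in> Pi\<^sub>E UNIV U"
      using U(2) i by (auto simp: PiE_iff)
    then have "x(i := \<not> x i) = x"
      using U(3) by blast
    then show False
      by (metis fun_upd_same)
  qed
  then have "?T interior_of {x} = {}"
    using openin_interior_of[of ?T "{x}"] interior_of_subset[of ?T "{x}"] by (metis subset_singletonD)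
  then show ?thesis
    using closed by (simp add: nowhere_dense_in_def closure_of_closedin)
qed

lemma cantor_ideal_meagre: "cantor_ideal meagre_ideal"
proof
  let ?T = "cantor_space (UNIV :: nat set)"
  show "(\<Union>n. Y n) \<in> meagre_ideal" if "\<And>n. Y n \<in> meagre_ideal" for Y :: "nat \<Rightarrow> _"
  proof -
    have "\<forall>n. \<exists>F. countable F \<and> (\<forall>N\<in>F. nowhere_dense_in ?T N) \<and> Y n = \<Union>F"
      using that by (simp add: meagre_ideal_def meagre_in_def)
    then obtain F where F: "\<And>n. countable (F n)" "\<And>n N. N \<in> F n \<Longrightarrow> nowhere_dense_in ?T N"
        "\<And>n. Y n = \<Union>(F n)"
      by metis
    have "countable (\<Union>n. F n)" "\<forall>N\<in>(\<Union>n. F n). nowhere_dense_in ?T N" "(\<Union>n. Y n) = \<Union>(\<Union>n. F n)"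
      using F by auto
    then show ?thesis
      unfolding meagre_ideal_def meagre_in_def by blast
  qed
  show "{f. f \<circ> \<sigma> \<in> Y} \<in> meagre_ideal" if "Y \<in> meagre_ideal" "inj \<sigma>" for Y \<sigma>
  proof -
    obtain F where F: "countable F" "\<And>N. N \<in> F \<Longrightarrow> nowhere_dense_in ?T N" "Y = \<Union>F"
      using \<open>Y \<in> meagre_ideal\<close> by (auto simp: meagre_ideal_def meagre_in_def)
    let ?F = "(\<lambda>N. {f. f \<circ> \<sigma> \<in> N}) ` F"
    have "countable ?F" "\<forall>N\<in>?F. nowhere_dense_in ?T N" "{f. f \<circ> \<sigma> \<in> Y} = \<Union>?F"
      using F nowhere_dense_reindex[OF \<open>inj \<sigma>\<close>] by auto
    then show ?thesis
      unfolding meagre_ideal_def meagre_in_def by blast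
  qed
  show "{x} \<in> meagre_ideal" for x
    using nowhere_dense_singleton unfolding meagre_ideal_def meagre_in_def
    by (auto intro!: exI[of _ "{{x}}"])
  show "UNIV \<notin> meagre_ideal"
  proof
    assume "UNIV \<in> meagre_ideal"
    then obtain F where F: "countable F" "\<And>N. N \<in> F \<Longrightarrow> nowhere_dense_in ?T N" "UNIV = \<Union>F"
      by (auto simp: meagre_ideal_def meagre_in_def)
    \<comment> \<open>The hypotheses of Baire's theorem, which is applied to the closures of the
      members of \<open>F\<close>.\<close>
    have "locally_compact_space ?T \<and> regular_space ?T"
      using compact_cantor_space[of "UNIV :: nat set"] Hausdorff_cantor_space[of "UNIV :: nat set"]
      by (simp add: compact_imp_locally_compact_space compact_Hausdorff_imp_regular_space)
    then have "?T interior_of \<Union>((closure_of) ?T ` F) = {}"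
      using F(1,2) by (intro Baire_category_alt) (auto simp: nowhere_dense_in_def)
    moreover have "N \<subseteq> ?T closure_of N" if "N \<in> F" for N
      using F(2)[OF that] by (intro closure_of_subset) (simp add: nowhere_dense_in_def)
    then have "\<Union>F \<subseteq> \<Union>((closure_of) ?T ` F)"
      by (rule UN_mono[OF subset_refl, of F "\<lambda>N. N", simplified])
    then have "\<Union>((closure_of) ?T ` F) = UNIV"
      using F(3) by auto
    ultimately show False
      using interior_of_topspace[of ?T] by simp
  qed
qed

lemma cantor_ideal_null: "cantor_ideal null_ideal"
proof -
  let ?C = "uniform_count_measure (UNIV :: bool set)"
  let ?M = "\<Pi>\<^sub>M i\<in>(UNIV :: nat set). ?C"
  have coin: "prob_space ?C"
    by (rule prob_space_uniform_count_measure) auto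
  interpret coin: prob_space ?C
    by (rule coin)
  interpret sequence_space ?C ..
  have space_M: "space ?M = UNIV"
    by (simp add: space_PiM space_uniform_count_measure)
  show ?thesis
  proof
    show "(\<Union>n. Y n) \<in> null_ideal" if "\<And>n. Y n \<in> null_ideal" for Y :: "nat \<Rightarrow> _"
      using that by (auto simp: null_ideal_def)
    show "{f. f \<circ> \<sigma> \<in> Y} \<in> null_ideal" if Y: "Y \<in> null_ideal" and \<sigma>: "inj \<sigma>" for Y \<sigma>
    proof -
      obtain N where N: "N \<in> null_sets ?M" "Y \<subseteq> N"
        using Y by (auto simp: null_ideal_def null_sets_completion_iff2)
      let ?r = "\<lambda>f :: nat \<Rightarrow> bool. f \<circ> \<sigma>"
      have r: "?r \<in> measurable ?M ?M"
        unfolding comp_def by (rule measurable_PiM_single') (auto simp: space_PiM)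
      \<comment> \<open>The coordinates are independent with a common law, so an injective selection
        of them has the same joint law.\<close>
      have "distr ?M ?M ?r = ?M"
        using distr_PiM_reindex[of UNIV "\<lambda>_. ?C" \<sigma> UNIV] coin \<sigma> by (simp add: comp_def restrict_def)
      then have "?r -` N \<inter> space ?M \<in> null_sets ?M"
        using N(1) r by (metis null_sets_distr_iff)
      moreover have "{f. f \<circ> \<sigma> \<in> Y} \<subseteq> ?r -` N \<inter> space ?M"
        using N(2) by (auto simp: space_M)
      ultimately show ?thesis
        unfolding null_ideal_def null_sets_completion_iff2 by blast
    qed
    show "{x} \<in> null_ideal" for x
    proof -
      have half: "measure ?C {b} = 1 / 2" for b
        by (simp add: measure_uniform_count_measure)
      \<comment> \<open>The product runs over \<open>i \<le> n\<close>, hence the exponent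
        \<open>Suc n\<close>.\<close>
      have "(\<lambda>n. (1 / 2) ^ Suc n) \<longlonglongrightarrow> measure ?M (Pi UNIV (\<lambda>i. {x i}))"
        using measure_PiM_countable[of "\<lambda>i. {x i}"] by (simp add: half sets_uniform_count_measure)
      moreover have "(\<lambda>n. (1 / 2 :: real) ^ Suc n) \<longlonglongrightarrow> 0"
        by (rule LIMSEQ_Suc[OF LIMSEQ_realpow_zero]) auto
      moreover have "Pi UNIV (\<lambda>i. {x i}) = {x}"
        by (auto simp: Pi_iff)
      ultimately have "measure ?M {x} = 0"
        using LIMSEQ_unique by metis
      moreover have "{x} \<in> sets ?M"
        using infprod_in_sets[of "\<lambda>i. {x i}"] \<open>Pi UNIV (\<lambda>i. {x i}) = {x}\<close>
        by (simp add: sets_uniform_count_measure)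
      ultimately have "{x} \<in> null_sets ?M"
        by (simp add: null_sets_def P.emeasure_eq_measure)
      then show ?thesis
        by (simp add: null_ideal_def null_sets_completionI)
    qed
    show "UNIV \<notin> null_ideal"
    proof
      assume "UNIV \<in> null_ideal"
      then have "space ?M \<in> null_sets ?M"
        unfolding null_ideal_def space_M[symmetric] null_sets_completion_iff[OF sets.top] .
      then show False
        using P.emeasure_space_1 by (simp add: null_sets_def)
    qed
  qed
qed

section \<open>The continuum as an instance, and the conclusion\<close>

text \<open>Supplies the cardinal for the concrete example: the pairing function recodes a sequence
  of binary sequences as one binary sequence.\<close>

lemma cantor_power_natLeq:
  defines "\<kappa> \<equiv> |UNIV :: (nat \<Rightarrow> bool) set|"
  shows "Cinfinite \<kappa>" and "\<kappa> ^c natLeq =o \<kappa>"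
proof -
  have "infinite (UNIV :: (nat \<Rightarrow> bool) set)"
    by (simp add: finite_UNIV_fun infinite_UNIV_nat)
  then show "Cinfinite \<kappa>"
    unfolding \<kappa>_def cinfinite_def
    using card_of_Card_order[of "UNIV :: (nat \<Rightarrow> bool) set"] by (simp add: Field_card_of)
  let ?f = "\<lambda>s :: nat \<Rightarrow> nat \<Rightarrow> bool. case_prod s \<circ> prod_decode"
  have "bij ?f"
  proof (rule o_bij[of "\<lambda>g. curry (g \<circ> prod_encode)"])
    show "(\<lambda>g. curry (g \<circ> prod_encode)) \<circ> ?f = id" "?f \<circ> (\<lambda>g. curry (g \<circ> prod_encode)) = id"
      by (simp_all add: fun_eq_iff)
  qed
  then have "|UNIV :: (nat \<Rightarrow> nat \<Rightarrow> bool) set| =o |UNIV :: (nat \<Rightarrow> bool) set|"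
    by (rule card_of_ordIsoI)
  then show "\<kappa> ^c natLeq =o \<kappa>"
    by (simp add: \<kappa>_def cexp_def Field_natLeq Field_card_of Func_def)
qed

lemma ideal_algebra_properties:
  fixes \<kappa> :: "'k rel"
  assumes \<kappa>: "Cinfinite \<kappa>" "\<kappa> ^c natLeq =o \<kappa>" and I: "I \<in> {meagre_ideal, null_ideal}"
  shows "boolean_lattice (ideal_algebra I (Field \<kappa>))"
    and "boolean_ultrafilter (ideal_algebra I (Field \<kappa>)) U \<Longrightarrow>
           tukey_maximal (ideal_algebra I (Field \<kappa>)) U"
    and "\<not> free_boolean_lattice (ideal_algebra I (Field \<kappa>))"
    and "infinite (carrier (ideal_algebra I (Field \<kappa>)))"
proof -
  have "cantor_ideal I"
    using I cantor_ideal_meagre cantor_ideal_null by auto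
  then interpret coordinate_algebra "Field \<kappa> \<rightarrow>\<^sub>E UNIV" "clopen_sigma_algebra (Field \<kappa>)"
      "lift_ideal I (Field \<kappa>)" "Field \<kappa>" "\<lambda>\<alpha> b. {f \<in> Field \<kappa> \<rightarrow>\<^sub>E UNIV. f \<alpha> = b}"
    using \<kappa>(1) by (intro cantor_ideal.coordinate_algebra_ideal_algebra) (auto simp: cinfinite_def)
  have "|carrier Q| \<le>o |clopen_sigma_algebra (Field \<kappa>)|"
    unfolding carrier_Q by (rule card_of_image)
  also have "|clopen_sigma_algebra (Field \<kappa>)| \<le>o \<kappa>"
    using \<kappa> by (intro card_clopen_sigma_algebra ordIso_imp_ordLeq)
  also have "\<kappa> =o |Field \<kappa>|"
    using \<kappa>(1) by (simp add: card_of_Field_ordIso ordIso_symmetric)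
  finally have card: "|carrier Q| \<le>o |Field \<kappa>|" .
  show "boolean_lattice (ideal_algebra I (Field \<kappa>))"
    and "boolean_ultrafilter (ideal_algebra I (Field \<kappa>)) U \<Longrightarrow>
           tukey_maximal (ideal_algebra I (Field \<kappa>)) U"
    and "\<not> free_boolean_lattice (ideal_algebra I (Field \<kappa>))"
    and "infinite (carrier (ideal_algebra I (Field \<kappa>)))"
    using boolean_lattice_Q tukey_maximal_ultrafilter[OF _ card] not_free infinite_carrier
    by (simp_all add: ideal_algebra_def)
qed

theorem mainTheorem2:
  shows "(\<forall>(\<kappa> :: 'k rel) I.
            Cinfinite \<kappa> \<and> \<kappa> ^c natLeq =o \<kappa> \<and> I \<in> {meagre_ideal, null_ideal} \<longrightarrow>
              boolean_lattice (ideal_algebra I (Field \<kappa>)) \<and>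
              (\<forall>U. boolean_ultrafilter (ideal_algebra I (Field \<kappa>)) U \<longrightarrow>
                   tukey_maximal (ideal_algebra I (Field \<kappa>)) U) \<and>
              \<not> free_boolean_lattice (ideal_algebra I (Field \<kappa>))) \<and>
         (\<exists>L :: ((nat \<Rightarrow> bool) \<Rightarrow> bool) set set gorder.
            boolean_lattice L \<and> infinite (carrier L) \<and>
            (\<forall>U. boolean_ultrafilter L U \<longrightarrow> tukey_maximal L U) \<and>
            \<not> free_boolean_lattice L)"
proof (intro conjI allI impI)
  let ?\<kappa> = "|UNIV :: (nat \<Rightarrow> bool) set|"
  \<comment> \<open>The null ideal would serve equally well here.\<close>
  let ?L = "ideal_algebra meagre_ideal (Field ?\<kappa>)"
  have "boolean_lattice ?L \<and> infinite (carrier ?L) \<and>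
      (\<forall>U. boolean_ultrafilter ?L U \<longrightarrow> tukey_maximal ?L U) \<and> \<not> free_boolean_lattice ?L"
    using ideal_algebra_properties[OF cantor_power_natLeq, of meagre_ideal] by blast
  then show "\<exists>L :: ((nat \<Rightarrow> bool) \<Rightarrow> bool) set set gorder.
      boolean_lattice L \<and> infinite (carrier L) \<and>
      (\<forall>U. boolean_ultrafilter L U \<longrightarrow> tukey_maximal L U) \<and> \<not> free_boolean_lattice L"
    by blast
next
  fix \<kappa> :: "'k rel" and I
  assume "Cinfinite \<kappa> \<and> \<kappa> ^c natLeq =o \<kappa> \<and> I \<in> {meagre_ideal, null_ideal}"
  then have \<kappa>: "Cinfinite \<kappa>" "\<kappa> ^c natLeq =o \<kappa>" "I \<in> {meagre_ideal, null_ideal}"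
    by auto
  show "boolean_lattice (ideal_algebra I (Field \<kappa>))"
    by (rule ideal_algebra_properties(1)[OF \<kappa>])
  show "tukey_maximal (ideal_algebra I (Field \<kappa>)) U"
    if "boolean_ultrafilter (ideal_algebra I (Field \<kappa>)) U" for U
    by (rule ideal_algebra_properties(2)[OF \<kappa> that])
  show "\<not> free_boolean_lattice (ideal_algebra I (Field \<kappa>))"
    by (rule ideal_algebra_properties(3)[OF \<kappa>])
qed

end
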